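(* Let $c>0$ be an arbitrary constant. There exist constants $C>0$ and $\kappa>0$ (depending only on $c$) such that the following holds for every integer $n\ge 2$ and every real $\varepsilon=\varepsilon(n)$ with $c<\varepsilon\le \frac{n}{\log_e(n)}-2$. Let $p=\frac{(2+\varepsilon)\log_e(n)}{n}$ (so $p\le 1$), let $G$ be drawn from $G(n,p)$, let $Z$ be the number of pure Nash equilibria of a graphical game sampled from $\mathcal{D}_{(n,p)}$ with underlying graph $G$, and let $W$ be a $\mathrm{Poisson}(1)$ random variable. Then, with probability at least $1-2n^{-\varepsilon/8}$ over the choice of $G$ from $G(n,p)$, the total variation distance between the conditional distribution of $Z$ given $G$ (i.e. the distribution of the number of pure Nash equilibria under $\mathcal{D}_G$) and $W$ satisfies $$\|Z-W\|\le C\,n^{-\varepsilon/8}+\exp(-\kappa n).$$ In other words, $\mathbb{P}_{\mathcal{G}}\big[\|Z-W\|\le C n^{-\varepsilon/8}+\exp(-\kappa n)\big]\ge 1-2n^{-\varepsilon/8}$. In particular, for $p=p(n)=\frac{(2+\varepsilon(n))\log_e(n)}{n}$ with $c<\varepsilon(n)\le \frac{n}{\log_e(n)}-2$, the distribution of $Z$ (when the game is sampled from $\mathcal{D}_{(n,p)}$) converges in total variation distance to a $\mathrm{Poisson}(1)$ distribution as $n\to+\infty$.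
   Context: Graphs are finite, simple and undirected. For a graph $G=(V,E)$ and $v\in V$, $\mathcal{N}(v)=\{v'\in V: (v,v')\in E\}$. Random best-response model $\mathcal{D}_G$: the players are the vertices of $G$, each player $v$ has strategy set $S_v=\{0,1\}$. A (binary) game on $G$ is specified by best-response tables $\mathrm{BR}_v:\{0,1\}\times\{0,1\}^{\mathcal{N}(v)}\to\{0,1\}$, $v\in V$. Under $\mathcal{D}_G$, the values $\mathrm{BR}_v(0,\sigma_{\mathcal{N}(v)})$, over all $v\in V$ and all $\sigma_{\mathcal{N}(v)}\in\{0,1\}^{\mathcal{N}(v)}$, are mutually independent and uniform in $\{0,1\}$, and $\mathrm{BR}_v(1,\sigma_{\mathcal{N}(v)})=1-\mathrm{BR}_v(0,\sigma_{\mathcal{N}(v)})$. (This is the law, up to probability-zero events, of the best-response tables of a graphical game on $G$ all of whose payoff entries are i.i.d. from an atomless distribution on $\mathbb{R}$, where $\mathrm{BR}_v(\sigma_v,\sigma_{\mathcal{N}(v)})=1$ iff $\sigma_v$ maximizes the payoff of $v$ given $\sigma_{\mathcal{N}(v)}$.) A pure Nash equilibrium (PNE) is a profile $\sigma\in\{0,1\}^V$ with $\mathrm{BR}_v(\sigma_v,\sigma_{\mathcal{N}(v)})=1$ for all $v\in V$. The measure $\mathcal{D}_{(n,p)}$: first draw $G$ from the Erdős–Rényi model $G(n,p)$ ($n$ vertices, each edge present independently with probability $p$), then draw a game from $\mathcal{D}_G$. $\mathbb{P}_{\mathcal{G}}$ denotes probability with respect to $G(n,p)$. Total variation distance of two random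 variables $Z,Z'$ supported on $\{0,1,2,\ldots\}$ is normalized as $\|Z-Z'\|=\sum_{i=0}^\infty |\Pr[Z=i]-\Pr[Z'=i]|$. *)

theory Defs
  imports "HOL-Probability.Probability"
begin

text \<open>
  A finite simple undirected graph is given by a finite vertex set \<open>V\<close> and a set \<open>E\<close> of
  edges, each edge being a two-element subset of \<open>V\<close>.
\<close>

definition all_edges :: "'a set \<Rightarrow> 'a set set" where
  "all_edges V = {e. e \<subseteq> V \<and> card e = 2}"

definition neighbours :: "'a set \<Rightarrow> 'a set set \<Rightarrow> 'a \<Rightarrow> 'a set" where
  "neighbours V E v = {v' \<in> V. {v, v'} \<in> E}"

text \<open>The Erdos--Renyi model on the vertex set \<open>{..<n}\<close>; an outcome is the set of edges.\<close>

definition erdos_renyi_pmf :: "nat \<Rightarrow> real \<Rightarrow> nat set set pmf" where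
  "erdos_renyi_pmf n p =
     map_pmf (\<lambda>f. {e \<in> all_edges {..<n}. f e})
       (Pi_pmf (all_edges {..<n}) False (\<lambda>_. bernoulli_pmf p))"

text \<open>
  The values \<open>0\<close> and \<open>1\<close>, both as strategies and as entries of best-response tables, are
  encoded as \<open>False\<close> and \<open>True\<close>. The elements of \<open>{0,1}\<^sup>A\<close> are the extensional functions
  \<open>A \<rightarrow>\<^sub>E UNIV\<close>, so that distinct functions are distinct profiles. In a game, \<open>BR v s \<tau>\<close> is the
  table entry of player \<open>v\<close> at own strategy \<open>s\<close> and neighbours' strategies \<open>\<tau>\<close>; it is meaningful
  only for \<open>v \<in> V\<close> and \<open>\<tau> \<in> neighbours V E v \<rightarrow>\<^sub>E UNIV\<close>.
\<close>

type_synonym 'a game = "'a \<Rightarrow> bool \<Rightarrow> ('a \<Rightarrow> bool) \<Rightarrow> bool"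

definition profiles :: "'a set \<Rightarrow> ('a \<Rightarrow> bool) set" where
  "profiles A = (A \<rightarrow>\<^sub>E (UNIV :: bool set))"

definition game_pmf :: "'a set \<Rightarrow> 'a set set \<Rightarrow> 'a game pmf" where
  "game_pmf V E =
     map_pmf (\<lambda>T v s \<tau>. if s then \<not> T (v, \<tau>) else T (v, \<tau>))
       (Pi_pmf (SIGMA v:V. profiles (neighbours V E v)) False
          (\<lambda>_. pmf_of_set (UNIV :: bool set)))"

definition pure_nash_equilibria :: "'a set \<Rightarrow> 'a set set \<Rightarrow> 'a game \<Rightarrow> ('a \<Rightarrow> bool) set" where
  "pure_nash_equilibria V E BR =
     {\<sigma> \<in> profiles V. \<forall>v\<in>V. BR v (\<sigma> v) (restrict \<sigma> (neighbours V E v))}"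

definition num_pne_pmf :: "'a set \<Rightarrow> 'a set set \<Rightarrow> nat pmf" where
  "num_pne_pmf V E = map_pmf (\<lambda>BR. card (pure_nash_equilibria V E BR)) (game_pmf V E)"

definition random_graph_game_pmf :: "nat \<Rightarrow> real \<Rightarrow> (nat set set \<times> nat game) pmf" where
  "random_graph_game_pmf n p =
     do {
       E \<leftarrow> erdos_renyi_pmf n p;
       BR \<leftarrow> game_pmf {..<n} E;
       return_pmf (E, BR)
     }"

definition random_num_pne_pmf :: "nat \<Rightarrow> real \<Rightarrow> nat pmf" where
  "random_num_pne_pmf n p =
     map_pmf (\<lambda>(E, BR). card (pure_nash_equilibria {..<n} E BR)) (random_graph_game_pmf n p)"

text \<open>Total variation distance, normalized without the factor \<open>1/2\<close>.\<close>

definition tv_dist :: "nat pmf \<Rightarrow> nat pmf \<Rightarrow> real" where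
  "tv_dist P Q = (\<Sum>i. \<bar>pmf P i - pmf Q i\<bar>)"

end

theory Submission
  imports Defs "HOL-Real_Asymp.Real_Asymp"
begin

text \<open>
  For a fixed graph, each profile is an equilibrium with probability \<open>2\<^sup>-\<^sup>n\<close>, so the expected number
  of equilibria is 1, and two profiles are independent unless some player sees the same strategies
  of its neighbours in both. The Chen--Stein method therefore bounds the distance to the Poisson
  distribution by an error that depends only on how many players have no neighbour in the set
  \<open>x\<close> on which two profiles differ, summed over all \<open>x\<close>. Averaged over the random graph, the error
  of a set of size \<open>s\<close> is \<open>((1 + (1 - p)\<^sup>s)\<^sup>n\<^sup>-\<^sup>s - 1) / 2\<^sup>n\<close> up to constants, and the sum over all nonempty
  sets is \<open>O(n powr (- \<epsilon> / 4))\<close>, uniformly in \<open>\<epsilon>\<close>. Markov's inequality then gives the bound with high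
  probability, with \<open>\<kappa> = 1\<close>, and convexity of the distance gives the limit.
\<close>

section \<open>Total variation distance and the Chen--Stein bound\<close>

text \<open>The 2 in \<open>2 + \<epsilon>\<close> is a threshold: for a uniformly random set
  \<open>x\<close>, a given player has no neighbour in \<open>x\<close> with probability about exp(-
  p n / 2), and n times this is n powr (- \<epsilon> / 2). No structural description of a typical
  graph (degrees, expansion) is required: the Chen-Stein error is averaged over the graph before it
  is estimated, and the dangerous weight \<open>2 ^ k\<close>, for \<open>k\<close> shared table
  entries, has an exact expectation. The price is the passage from \<epsilon> / 4 in the mean to
  \<epsilon> / 8 for both the error and the failure probability. The obstacle in the estimates is
  uniformity in \<epsilon>. When \<epsilon> is of order n / ln n, the target n powr (- \<epsilon> /
  4) is itself exponentially small in n, so a bound exp(- \<gamma> n) with \<gamma> depending on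
  \<open>c\<close> alone does not suffice. Each range of set sizes must either keep \<open>p\<close>
  in the exponent or force \<epsilon> to be bounded.\<close>

lemma expectation_pmf_nat_sums:
  fixes h :: "nat \<Rightarrow> real"
  assumes "\<And>i. \<bar>h i\<bar> \<le> B"
  shows "(\<lambda>i. pmf P i * h i) sums measure_pmf.expectation P h"
proof -
  have int: "integrable (measure_pmf P) h"
    using assms by (intro measure_pmf.integrable_const_bound[where B = B]) auto
  have eq: "measure_pmf P = density (count_space UNIV) (pmf P)"
    by (rule measure_pmf_eq_density)
  have "integrable (count_space UNIV) (\<lambda>i. pmf P i *\<^sub>R h i)"
    using int unfolding eq by (subst (asm) integrable_density) auto
  moreover have "measure_pmf.expectation P h = integral\<^sup>L (count_space UNIV) (\<lambda>i. pmf P i *\<^sub>R h i)"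
    unfolding eq by (subst integral_density) auto
  ultimately show ?thesis
    using sums_integral_count_space_nat[of "\<lambda>i. pmf P i *\<^sub>R h i"] by simp
qed

text \<open>Without the factor 1/2 the distance is the supremum of differences of expectations over
  test functions bounded by 1, and the sign of the difference of the mass functions attains it.
  Stein's method bounds exactly such differences.\<close>

lemma tv_dist_le:
  assumes "\<And>h :: nat \<Rightarrow> real. (\<And>i. \<bar>h i\<bar> \<le> 1) \<Longrightarrow>
             measure_pmf.expectation P h - measure_pmf.expectation Q h \<le> t"
  shows "tv_dist P Q \<le> t"
proof -
  define h :: "nat \<Rightarrow> real" where "h i = sgn (pmf P i - pmf Q i)" for i
  have h: "\<bar>h i\<bar> \<le> 1" for i
    by (simp add: h_def sgn_if)
  have "(\<lambda>i. pmf P i * h i - pmf Q i * h i) sums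
          (measure_pmf.expectation P h - measure_pmf.expectation Q h)"
    by (intro sums_diff expectation_pmf_nat_sums[OF h])
  moreover have "pmf P i * h i - pmf Q i * h i = \<bar>pmf P i - pmf Q i\<bar>" for i
    by (simp add: h_def sgn_if abs_if algebra_simps)
  ultimately have "tv_dist P Q = measure_pmf.expectation P h - measure_pmf.expectation Q h"
    unfolding tv_dist_def by (simp add: sums_iff)
  thus ?thesis
    using assms[of h] h by simp
qed

lemma summable_abs_pmf_diff: "summable (\<lambda>i :: nat. \<bar>pmf P i - pmf Q i\<bar>)"
proof (rule summable_comparison_test')
  show "summable (\<lambda>i. pmf P i * 1 + pmf Q i * 1)"
    by (intro summable_add sums_summable[OF expectation_pmf_nat_sums[where B = 1]]) auto
  show "norm \<bar>pmf P i - pmf Q i\<bar> \<le> pmf P i * 1 + pmf Q i * 1" if "i \<ge> 0" for i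
    using pmf_nonneg[of P i] pmf_nonneg[of Q i] by (simp add: abs_le_iff)
qed

lemma tv_dist_nonneg: "0 \<le> tv_dist P Q"
  unfolding tv_dist_def by (rule suminf_nonneg[OF summable_abs_pmf_diff]) simp

text \<open>Divided by k!, the recurrence telescopes, so f k / (k-1)! is a partial sum of
  \<open>c\<close>. The total sum of \<open>c\<close> is 0 because \<mu> is the Poisson mean of
  \<open>h\<close>; hence the partial sum is minus a tail, and only the tail form shows that the
  factor (k-1)! does no harm.\<close>

lemma poisson_stein_equation:
  fixes h :: "nat \<Rightarrow> real"
  assumes h: "\<And>i. \<bar>h i\<bar> \<le> 1"
  shows "\<exists>f :: nat \<Rightarrow> real.
    (\<forall>k. f (Suc k) - real k * f k = h k - measure_pmf.expectation (poisson_pmf 1) h) \<and>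
    (\<forall>k. \<bar>f k\<bar> \<le> 6)"
proof -
  define \<mu> where "\<mu> = measure_pmf.expectation (poisson_pmf 1) h"
  define c where "c k = (h k - \<mu>) / fact k" for k
  \<comment> \<open>At \<open>k = 0\<close> truncated subtraction leaves the full sum of
    \<open>c\<close>, so \<open>f 0 = 0\<close>.\<close>
  define f where "f k = - (fact (k - 1) * (\<Sum>i. c (i + k)))" for k
  have e: "(\<lambda>i. 1 / fact i :: real) sums exp 1"
    using exp_converges[of "1::real"] by (simp add: divide_inverse)
  have "\<bar>\<mu>\<bar> \<le> measure_pmf.expectation (poisson_pmf 1) (\<lambda>_. 1)"
    unfolding \<mu>_def using h
    by (intro order.trans[OF integral_abs_bound] integral_mono
          measure_pmf.integrable_const_bound[where B = 1]) auto
  hence \<mu>: "\<bar>\<mu>\<bar> \<le> 1"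
    by simp
  have c_le: "\<bar>c k\<bar> \<le> 2 * (1 / fact k)" for k
  proof -
    have "\<bar>h k - \<mu>\<bar> \<le> 2"
      using h[of k] \<mu> by linarith
    hence "\<bar>h k - \<mu>\<bar> / fact k \<le> 2 / fact k"
      by (intro divide_right_mono) auto
    thus ?thesis
      by (simp add: c_def)
  qed
  have "(\<lambda>i. (1 / fact i * h i) * exp (-1)) sums \<mu>"
    using expectation_pmf_nat_sums[of h 1 "poisson_pmf 1"] h by (simp add: \<mu>_def mult_ac)
  hence "(\<lambda>i. (1 / fact i * h i) * exp (-1) * exp 1) sums (\<mu> * exp 1)"
    by (rule sums_mult2)
  hence "(\<lambda>i. 1 / fact i * h i) sums (\<mu> * exp 1)"
    by (simp only: mult.assoc exp_add[symmetric]) simp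
  hence "(\<lambda>i. 1 / fact i * h i - \<mu> * (1 / fact i)) sums (\<mu> * exp 1 - \<mu> * exp 1)"
    by (intro sums_diff sums_mult e)
  hence "c sums 0"
    by (simp add: c_def[abs_def] diff_divide_distrib)
  hence c0: "summable c" "suminf c = 0"
    by (auto simp: sums_iff)
  have tail: "(\<Sum>i. c (i + k)) = c k + (\<Sum>i. c (i + Suc k))" for k
    using suminf_split_head[of "\<lambda>i. c (i + k)"] summable_ignore_initial_segment[OF c0(1), of k]
    by simp
  have "f (Suc k) - real k * f k = h k - \<mu>" for k
  proof -
    have "real k * (fact (k - 1) * (\<Sum>i. c (i + k))) = fact k * (\<Sum>i. c (i + k))"
      using c0 by (cases k) simp_all
    hence "f (Suc k) - real k * f k = fact k * c k"
      unfolding f_def tail[of k] by (simp add: algebra_simps)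
    thus ?thesis
      by (simp add: c_def)
  qed
  moreover have "\<bar>f k\<bar> \<le> 6" for k
  proof (cases k)
    case 0
    thus ?thesis
      using c0 by (simp add: f_def)
  next
    case (Suc m)
    \<comment> \<open>With m = k - 1, the tail is dominated termwise by the exponential series,
      which yields 2 e <= 6.\<close>
    have bd: "norm (fact m * c (i + k)) \<le> 2 * (1 / fact i)" for i
    proof -
      have "fact m * fact i \<le> (fact (i + k) :: real)"
      proof -
        have "fact m * fact i \<le> (fact (m + i) :: nat)"
          by (intro dvd_imp_le fact_fact_dvd_fact) simp
        hence "real (fact m * fact i) \<le> real (fact (m + i))"
          by (rule of_nat_mono)
        hence "fact m * fact i \<le> (fact (m + i) :: real)"
          by simp
        also have "\<dots> \<le> fact (i + k)"
          using Suc by (intro fact_mono) simp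
        finally show ?thesis .
      qed
      hence "fact m / fact (i + k) \<le> (1 / fact i :: real)"
        by (simp add: pos_divide_le_eq pos_le_divide_eq)
      moreover have "norm (fact m * c (i + k)) \<le> fact m * (2 * (1 / fact (i + k)))"
        unfolding norm_mult using c_le[of "i + k"] by (intro mult_mono) auto
      moreover have "fact m * (2 * (1 / fact (i + k))) = 2 * (fact m / fact (i + k) :: real)"
        by simp
      ultimately show ?thesis
        by linarith
    qed
    have "\<bar>f k\<bar> = norm (\<Sum>i. fact m * c (i + k))"
      unfolding suminf_mult[OF summable_ignore_initial_segment[OF c0(1)]] f_def
      by (simp only: Suc diff_Suc_1 abs_minus_cancel real_norm_def)
    also have "\<dots> \<le> (\<Sum>i. 2 * (1 / fact i))"
      by (intro norm_suminf_le bd summable_mult sums_summable[OF e])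
    also have "\<dots> = 2 * exp 1"
      by (simp add: suminf_mult[OF sums_summable[OF e]] sums_unique[OF e, symmetric] del: times_divide_eq_right)
    also have "\<dots> \<le> 6"
      using exp_le by simp
    finally show ?thesis .
  qed
  ultimately show ?thesis
    unfolding \<mu>_def by blast
qed

text \<open>The constant 12 is a crude bound on the oscillation of the solution of the Stein equation;
  the usual constant would be 2.\<close>

theorem chen_stein_poisson_1:
  fixes M :: "'w pmf" and X :: "'i \<Rightarrow> 'w \<Rightarrow> bool" and B :: "'i \<Rightarrow> 'i set"
  assumes fin: "finite (set_pmf M)" "finite I"
    and B: "\<And>i. i \<in> I \<Longrightarrow> B i \<subseteq> I" "\<And>i. i \<in> I \<Longrightarrow> i \<in> B i"
    and mean: "(\<Sum>i\<in>I. measure_pmf.prob M {w. X i w}) = 1"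
    and indep: "\<And>i (g :: nat \<Rightarrow> real). i \<in> I \<Longrightarrow>
      measure_pmf.expectation M (\<lambda>w. of_bool (X i w) * g (card {j \<in> I - B i. X j w})) =
      measure_pmf.prob M {w. X i w} * measure_pmf.expectation M (\<lambda>w. g (card {j \<in> I - B i. X j w}))"
  shows "tv_dist (map_pmf (\<lambda>w. card {i \<in> I. X i w}) M) (poisson_pmf 1)
    \<le> 12 * ((\<Sum>i\<in>I. \<Sum>j\<in>B i. measure_pmf.prob M {w. X i w} * measure_pmf.prob M {w. X j w}) +
            (\<Sum>i\<in>I. \<Sum>j\<in>B i - {i}. measure_pmf.prob M {w. X i w \<and> X j w}))"
proof (rule tv_dist_le)
  fix h :: "nat \<Rightarrow> real"
  assume h: "\<And>i. \<bar>h i\<bar> \<le> 1"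
  define E :: "('w \<Rightarrow> real) \<Rightarrow> real" where "E = measure_pmf.expectation M"
  define p where "p i = measure_pmf.prob M {w. X i w}" for i
  define W where "W w = card {i \<in> I. X i w}" for w
  define V where "V i w = card {j \<in> I - B i. X j w}" for i w
  obtain f where f: "\<And>k. f (Suc k) - real k * f k = h k - measure_pmf.expectation (poisson_pmf 1) h"
      "\<And>k. \<bar>f k\<bar> \<le> 6"
    using poisson_stein_equation[of h] h by auto
  have int [simp]: "integrable (measure_pmf M) (u :: 'w \<Rightarrow> real)" for u
    using fin(1) by (rule integrable_measure_pmf_finite)
  have E_prob: "E (\<lambda>w. of_bool (A w)) = measure_pmf.prob M {w. A w}" for A
  proof -
    have "E (indicator {w. A w}) = measure_pmf.prob M {w. A w}"
      unfolding E_def by simp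
    moreover have "indicator {w. A w} = (\<lambda>w. of_bool (A w) :: real)"
      by (auto simp: indicator_def)
    ultimately show ?thesis
      by simp
  qed
  have E_mono: "E u \<le> E v" if "\<And>w. u w \<le> v w" for u v
    unfolding E_def using that by (intro integral_mono) auto
  have E_sum: "E (\<lambda>w. \<Sum>i\<in>J. u i w) = (\<Sum>i\<in>J. E (u i))" for J :: "'i set" and u
    unfolding E_def by (intro Bochner_Integration.integral_sum) auto
  have E_diff: "E (\<lambda>w. u w - v w) = E u - E v" for u v
    unfolding E_def by (intro Bochner_Integration.integral_diff) auto
  have E_cmult: "E (\<lambda>w. a * u w) = a * E u" for u a
    unfolding E_def by simp
  have lip: "\<bar>f a - f b\<bar> \<le> 12 * real (a - b)" if "b \<le> a" for a b
    using f(2)[of a] f(2)[of b] that by (cases "a = b") auto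
  have finB: "finite (B i)" if "i \<in> I" for i
    using B(1)[OF that] fin(2) finite_subset by blast
  have card_sum: "real (card {j \<in> J. X j w}) = (\<Sum>j\<in>J. of_bool (X j w))" if "finite J" for J w
    using that by (simp add: sum.If_cases of_bool_def Int_def)
  have W_split: "W w = V i w + card {j \<in> B i. X j w}" if "i \<in> I" for i w
  proof -
    have "{j \<in> I. X j w} = {j \<in> I - B i. X j w} \<union> {j \<in> B i. X j w}"
      using B(1)[OF that] by auto
    thus ?thesis
      unfolding W_def V_def using fin(2) finB[OF that] by (simp add: card_Un_disjoint disjoint_iff)
  qed
  \<comment> \<open>\<open>f (Suc (V i w))\<close> is inserted between the two terms. Passing from
    \<open>W\<close> to \<open>V i\<close> costs the indices in \<open>B i\<close>, and for
    \<open>V i\<close> the independence hypothesis merges the product with \<open>p i\<close> into a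
    single expectation.\<close>
  have main: "p i * E (\<lambda>w. f (Suc (W w))) - E (\<lambda>w. of_bool (X i w) * f (W w))
      \<le> 12 * (p i * (\<Sum>j\<in>B i. p j)) + 12 * (\<Sum>j\<in>B i - {i}. E (\<lambda>w. of_bool (X i w \<and> X j w)))"
    if i: "i \<in> I" for i
  proof -
    have "E (\<lambda>w. f (Suc (W w))) - E (\<lambda>w. f (Suc (V i w)))
        = E (\<lambda>w. f (Suc (W w)) - f (Suc (V i w)))"
      by (simp add: E_diff)
    also have "\<dots> \<le> E (\<lambda>w. 12 * (\<Sum>j\<in>B i. of_bool (X j w)))"
    proof (rule E_mono)
      fix w
      show "f (Suc (W w)) - f (Suc (V i w)) \<le> 12 * (\<Sum>j\<in>B i. of_bool (X j w))"
        using lip[of "Suc (V i w)" "Suc (W w)"] W_split[OF i, of w]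
        by (simp flip: card_sum[OF finB[OF i]])
    qed
    also have "\<dots> = 12 * (\<Sum>j\<in>B i. p j)"
      by (simp add: E_cmult E_sum E_prob p_def)
    finally have "p i * (E (\<lambda>w. f (Suc (W w))) - E (\<lambda>w. f (Suc (V i w)))) \<le> p i * (12 * (\<Sum>j\<in>B i. p j))"
      by (intro mult_left_mono) (auto simp: p_def)
    moreover have "p i * E (\<lambda>w. f (Suc (V i w))) - E (\<lambda>w. of_bool (X i w) * f (W w))
        = E (\<lambda>w. of_bool (X i w) * f (Suc (V i w)) - of_bool (X i w) * f (W w))"
      using indep[OF i, of "\<lambda>k. f (Suc k)"] by (simp add: E_diff) (simp add: E_def p_def V_def)
    moreover have "\<dots> \<le> E (\<lambda>w. 12 * (\<Sum>j\<in>B i - {i}. of_bool (X i w \<and> X j w)))"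
    proof (rule E_mono)
      fix w
      show "of_bool (X i w) * f (Suc (V i w)) - of_bool (X i w) * f (W w)
          \<le> 12 * (\<Sum>j\<in>B i - {i}. of_bool (X i w \<and> X j w))"
      proof (cases "X i w")
        case True
        \<comment> \<open>On \<open>X i\<close> the index \<open>i\<close> itself supplies the
          \<open>Suc\<close>, so only \<open>B i - {i}\<close> contributes to the
          difference.\<close>
        have "{j \<in> B i. X j w} = insert i {j \<in> B i - {i}. X j w}"
          using True B(2)[OF i] by auto
        hence "W w = Suc (V i w) + card {j \<in> B i - {i}. X j w}"
          using W_split[OF i, of w] finB[OF i] by (simp add: card_insert_if)
        thus ?thesis
          using lip[of "Suc (V i w)" "W w"] True card_sum[of "B i - {i}" w] finB[OF i] by simp
      qed simp
    qed
    moreover have "\<dots> = 12 * (\<Sum>j\<in>B i - {i}. E (\<lambda>w. of_bool (X i w \<and> X j w)))"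
      by (simp only: E_cmult E_sum)
    ultimately show ?thesis
      by (simp add: algebra_simps)
  qed
  have "measure_pmf.expectation (map_pmf W M) h - measure_pmf.expectation (poisson_pmf 1) h
      = E (\<lambda>w. h (W w) - measure_pmf.expectation (poisson_pmf 1) h)"
    unfolding E_def by simp
  also have "\<dots> = E (\<lambda>w. f (Suc (W w)) - (\<Sum>i\<in>I. of_bool (X i w) * f (W w)))"
    unfolding f(1)[symmetric] using card_sum[OF fin(2)] by (simp add: W_def sum_distrib_right)
  also have "\<dots> = (\<Sum>i\<in>I. p i) * E (\<lambda>w. f (Suc (W w))) - (\<Sum>i\<in>I. E (\<lambda>w. of_bool (X i w) * f (W w)))"
    using mean by (simp only: E_diff E_sum p_def)
  also have "\<dots> = (\<Sum>i\<in>I. p i * E (\<lambda>w. f (Suc (W w))) - E (\<lambda>w. of_bool (X i w) * f (W w)))"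
    by (simp add: sum_distrib_right sum_subtractf)
  also have "\<dots> \<le> (\<Sum>i\<in>I. 12 * (p i * (\<Sum>j\<in>B i. p j))
                      + 12 * (\<Sum>j\<in>B i - {i}. E (\<lambda>w. of_bool (X i w \<and> X j w))))"
    by (intro sum_mono main)
  also have "\<dots> = 12 * ((\<Sum>i\<in>I. \<Sum>j\<in>B i. p i * p j) +
      (\<Sum>i\<in>I. \<Sum>j\<in>B i - {i}. measure_pmf.prob M {w. X i w \<and> X j w}))"
    by (simp only: E_prob sum.distrib sum_distrib_left distrib_left)
  finally show "measure_pmf.expectation (map_pmf (\<lambda>w. card {i \<in> I. X i w}) M) h
      - measure_pmf.expectation (poisson_pmf 1) h
    \<le> 12 * ((\<Sum>i\<in>I. \<Sum>j\<in>B i. measure_pmf.prob M {w. X i w} * measure_pmf.prob M {w. X j w}) +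
            (\<Sum>i\<in>I. \<Sum>j\<in>B i - {i}. measure_pmf.prob M {w. X i w \<and> X j w}))"
    unfolding W_def p_def .
qed

section \<open>Equilibria on a fixed graph\<close>

lemma expectation_of_bool:
  "measure_pmf.expectation M (\<lambda>w. of_bool (P w)) = measure_pmf.prob M {w. P w}"
proof -
  have "(\<lambda>w. of_bool (P w)) = (indicator {w. P w} :: _ \<Rightarrow> real)"
    by (auto simp: indicator_def)
  thus ?thesis
    by simp
qed

lemma expectation_pair_pmf_mult:
  fixes u :: "'a \<Rightarrow> real" and w :: "'b \<Rightarrow> real"
  assumes "finite (set_pmf P)" "finite (set_pmf Q)"
  shows "measure_pmf.expectation (pair_pmf P Q) (\<lambda>(x, y). u x * w y) =
    measure_pmf.expectation P u * measure_pmf.expectation Q w"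
proof -
  have "pair_pmf P Q = P \<bind> (\<lambda>x. map_pmf (Pair x) Q)"
    by (simp add: pair_pmf_def map_pmf_def)
  hence "measure_pmf.expectation (pair_pmf P Q) (\<lambda>(x, y). u x * w y) =
      (\<Sum>x\<in>set_pmf P. pmf P x * (u x * measure_pmf.expectation Q w))"
    using assms by (simp add: pmf_expectation_bind[of "set_pmf P"])
  also have "\<dots> = measure_pmf.expectation P u * measure_pmf.expectation Q w"
    using assms(1) by (simp add: integral_measure_pmf[of "set_pmf P"] sum_distrib_right mult.assoc)
  finally show ?thesis .
qed

section \<open>Independence among fair coins\<close>

abbreviation coin :: "bool pmf" where
  "coin \<equiv> pmf_of_set UNIV"

lemma finite_set_Pi_coin: "finite I \<Longrightarrow> finite (set_pmf (Pi_pmf I d (\<lambda>_. coin)))"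
  by (subst set_Pi_pmf) auto

text \<open>The event reads only coins in \<open>A\<close> and \<open>g\<close> only the others, so
  the product measure factorizes. All independence between profiles comes from here:
  \<open>g\<close> will be a function of the number of equilibria among the profiles that share no
  table entry with a given one.\<close>

lemma coin_cylinder:
  fixes g :: "('i \<Rightarrow> bool) \<Rightarrow> real"
  assumes I: "finite I" and A: "A \<subseteq> I"
    and g: "\<And>T T'. (\<And>i. i \<in> I - A \<Longrightarrow> T i = T' i) \<Longrightarrow> g T = g T'"
  shows "measure_pmf.expectation (Pi_pmf I d (\<lambda>_. coin)) (\<lambda>T. of_bool (\<forall>i\<in>A. T i = a i) * g T) =
    (1/2) ^ card A * measure_pmf.expectation (Pi_pmf I d (\<lambda>_. coin)) g"
proof -
  define P where "P = Pi_pmf A d (\<lambda>_. coin)"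
  define Q where "Q = Pi_pmf (I - A) d (\<lambda>_. coin)"
  have finA: "finite A"
    using A I finite_subset by blast
  have M: "Pi_pmf I d (\<lambda>_. coin) = map_pmf (\<lambda>(f, h) x. if x \<in> A then f x else h x) (pair_pmf P Q)"
    using Pi_pmf_union[of A "I - A" d "\<lambda>_. coin"] A I finA by (simp add: P_def Q_def Un_absorb1)
  have g': "g (\<lambda>x. if x \<in> A then f x else h x) = g h" for f h
    by (intro g) auto
  have "measure_pmf.prob P {f. \<forall>i\<in>A. f i = a i} = measure_pmf.prob P (Pi A (\<lambda>i. {a i}))"
    by (intro arg_cong[where f = "measure_pmf.prob P"]) auto
  also have "\<dots> = (1/2) ^ card A"
    unfolding P_def using finA by (simp add: measure_Pi_pmf_Pi measure_pmf_single power_one_over)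
  finally have P: "measure_pmf.prob P {f. \<forall>i\<in>A. f i = a i} = (1/2) ^ card A" .
  have "measure_pmf.expectation (Pi_pmf I d (\<lambda>_. coin)) g = measure_pmf.expectation Q g"
    unfolding M by (simp add: case_prod_unfold g')
  moreover have "measure_pmf.expectation (Pi_pmf I d (\<lambda>_. coin)) (\<lambda>T. of_bool (\<forall>i\<in>A. T i = a i) * g T)
    = measure_pmf.expectation (pair_pmf P Q) (\<lambda>(f, h). of_bool (\<forall>i\<in>A. f i = a i) * g h)"
    unfolding M by (simp add: case_prod_unfold g')
  moreover have "\<dots> = (1/2) ^ card A * measure_pmf.expectation Q g"
    using I finA by (subst expectation_pair_pmf_mult)
      (auto simp: P_def Q_def finite_set_Pi_coin expectation_of_bool P[unfolded P_def])
  ultimately show ?thesis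
    by simp
qed

corollary prob_coin_cylinder:
  assumes "finite I" "A \<subseteq> I"
  shows "measure_pmf.prob (Pi_pmf I d (\<lambda>_. coin)) {T. \<forall>i\<in>A. T i = a i} = (1/2) ^ card A"
  using coin_cylinder[OF assms, of "\<lambda>_. 1" d a] by (simp add: expectation_of_bool)

definition isolated_from :: "'a set \<Rightarrow> 'a set set \<Rightarrow> 'a set \<Rightarrow> 'a set" where
  "isolated_from V E x = {v \<in> V. neighbours V E v \<inter> x = {}}"

text \<open>In the Chen--Stein bound, \<open>x\<close> is the set of players on which two profiles differ; the
  profiles share a table entry exactly for the players in \<^term>\<open>isolated_from V E x\<close>. Players in \<open>x\<close> among these
  would make both profiles being equilibria impossible, and \<open>2 (2\<^sup>k - 1)\<close> bounds \<open>2\<^sup>k\<close> for \<open>k \<ge> 1\<close>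
  while vanishing for independent profiles (\<open>k = 0\<close>).\<close>

definition pne_error :: "'a set \<Rightarrow> 'a set set \<Rightarrow> real" where
  "pne_error V E = ((\<Sum>x\<in>Pow V. of_bool (isolated_from V E x \<noteq> {})) +
     (\<Sum>x\<in>Pow V - {{}}. 2 * (2 ^ card (isolated_from V E x - x) - 1))) / 2 ^ card V"

lemma pne_error_nonneg: "0 \<le> pne_error V E"
  unfolding pne_error_def by (intro divide_nonneg_nonneg add_nonneg_nonneg sum_nonneg) auto

section \<open>Strategy profiles as points of the cube\<close>

lemma finite_profiles: "finite A \<Longrightarrow> finite (profiles A)"
  unfolding profiles_def by (rule finite_PiE) auto

lemma card_profiles: "finite A \<Longrightarrow> card (profiles A) = 2 ^ card A"
  unfolding profiles_def by (simp add: card_PiE)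

text \<open>The inverse is exclusive or with \<sigma>. The bounds for a pair of profiles depend only
  on the difference set, so a sum over pairs is \<open>2 ^ n\<close> times a sum over subsets;
  against the probability 4^(-n) this leaves the denominator \<open>2 ^ card V\<close> of
  \<open>pne_error\<close>.\<close>

lemma bij_betw_profiles_Pow:
  assumes "\<sigma> \<in> profiles V"
  shows "bij_betw (\<lambda>\<tau>. {v \<in> V. \<sigma> v \<noteq> \<tau> v}) (profiles V) (Pow V)"
proof (rule bij_betw_byWitness[where f' = "\<lambda>x. restrict (\<lambda>v. \<sigma> v \<noteq> (v \<in> x)) V"])
  show "\<forall>\<tau>\<in>profiles V. restrict (\<lambda>v. \<sigma> v \<noteq> (v \<in> {v \<in> V. \<sigma> v \<noteq> \<tau> v})) V = \<tau>"
    by (auto simp: profiles_def fun_eq_iff PiE_def extensional_def)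
  show "(\<lambda>x. restrict (\<lambda>v. \<sigma> v \<noteq> (v \<in> x)) V) ` Pow V \<subseteq> profiles V"
    by (auto simp: profiles_def)
qed auto

text \<open>A profile reads exactly one table entry per player, so being an equilibrium is a
  cylinder event on n coins, and dependence between profiles is overlap of the entries they
  read.\<close>

theorem tv_dist_num_pne_le:
  assumes V: "finite V" "V \<noteq> {}"
  shows "tv_dist (num_pne_pmf V E) (poisson_pmf 1) \<le> 12 * pne_error V E"
proof -
  define N where "N = neighbours V E"
  define I where "I = (SIGMA v:V. profiles (N v))"
  define M where "M = Pi_pmf I False (\<lambda>_. coin)"
  define F where "F = isolated_from V E"
  define A where "A \<sigma> = (\<lambda>v. (v, restrict \<sigma> (N v))) ` V" for \<sigma> :: "'a \<Rightarrow> bool"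
  \<comment> \<open>The drawn bit is the entry at own strategy \<open>False\<close> and is negated
    at \<open>True\<close>, so a player's condition at \<sigma> holds iff the bit is the negation of
    its strategy.\<close>
  define a where "a \<sigma> i = (\<not> \<sigma> (fst i))" for \<sigma> and i :: "'a \<times> ('a \<Rightarrow> bool)"
  define X where "X \<sigma> T = (\<forall>i\<in>A \<sigma>. T i = a \<sigma> i)" for \<sigma> T
  define B where "B \<sigma> = {\<tau> \<in> profiles V. A \<sigma> \<inter> A \<tau> \<noteq> {}}" for \<sigma>
  define D where "D \<sigma> \<tau> = {v \<in> V. \<sigma> v \<noteq> \<tau> v}" for \<sigma> \<tau> :: "'a \<Rightarrow> bool"
  define n where "n = card V"
  have N: "N v \<subseteq> V" for v
    by (auto simp: N_def neighbours_def)
  have finI: "finite I"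
    unfolding I_def using V(1) N finite_subset by (intro finite_SigmaI finite_profiles) blast+
  have AI: "A \<sigma> \<subseteq> I" for \<sigma>
    by (auto simp: A_def I_def profiles_def)
  have inj: "inj_on (\<lambda>v. (v, restrict \<sigma> (N v))) S" for \<sigma> :: "'a \<Rightarrow> bool" and S
    by (auto simp: inj_on_def)
  have cardA: "card (A \<sigma>) = n" for \<sigma>
    unfolding A_def n_def by (intro card_image inj)
  have finA: "finite (A \<sigma>)" for \<sigma>
    using V(1) by (simp add: A_def)
  have prob_X: "measure_pmf.prob M {T. X \<sigma> T} = (1/2) ^ n" for \<sigma>
    unfolding M_def X_def by (subst prob_coin_cylinder[OF finI AI]) (simp add: cardA)
  have agree: "restrict \<sigma> (N v) = restrict \<tau> (N v) \<longleftrightarrow> N v \<inter> D \<sigma> \<tau> = {}" for \<sigma> \<tau> v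
    using N[of v] by (auto simp: D_def fun_eq_iff restrict_def)
  have A_Int: "A \<sigma> \<inter> A \<tau> = (\<lambda>v. (v, restrict \<sigma> (N v))) ` F (D \<sigma> \<tau>)" for \<sigma> \<tau>
  proof -
    have "A \<sigma> \<inter> A \<tau> = (\<lambda>v. (v, restrict \<sigma> (N v))) ` {v \<in> V. restrict \<sigma> (N v) = restrict \<tau> (N v)}"
      by (auto simp: A_def)
    thus ?thesis
      unfolding agree by (simp add: F_def isolated_from_def N_def)
  qed
  have FV: "F x \<subseteq> V" for x
    by (auto simp: F_def isolated_from_def)
  have B_iff: "\<tau> \<in> B \<sigma> \<longleftrightarrow> \<tau> \<in> profiles V \<and> F (D \<sigma> \<tau>) \<noteq> {}" for \<sigma> \<tau>
    by (simp add: B_def A_Int)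
  have prob_XX: "measure_pmf.prob M {T. X \<sigma> T \<and> X \<tau> T}
      \<le> 2 * (2 ^ card (F (D \<sigma> \<tau>) - D \<sigma> \<tau>) - 1) * (1/4) ^ n"
    if \<tau>: "\<tau> \<in> B \<sigma>" for \<sigma> \<tau>
  proof (cases "F (D \<sigma> \<tau>) \<inter> D \<sigma> \<tau> = {}")
    case True
    define k where "k = card (F (D \<sigma> \<tau>))"
    have k: "k = card (F (D \<sigma> \<tau>) - D \<sigma> \<tau>)"
      using True by (simp add: k_def Diff_triv)
    have "k > 0"
      using \<tau> finite_subset[OF FV V(1)] by (simp add: B_iff k_def card_gt_0_iff)
    have card_Int: "card (A \<sigma> \<inter> A \<tau>) = k"
      unfolding A_Int k_def by (intro card_image inj)
    have card_Un: "card (A \<sigma> \<union> A \<tau>) + k = 2 * n"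
      using card_Un_Int[of "A \<sigma>" "A \<tau>"] finA by (simp add: cardA card_Int)
    \<comment> \<open>The inclusion of events used next holds whether or not the two demands agree
      on the overlap, so no compatibility has to be checked for an upper bound.\<close>
    define b where "b i = (if i \<in> A \<sigma> then a \<sigma> i else a \<tau> i)" for i
    have "measure_pmf.prob M {T. X \<sigma> T \<and> X \<tau> T}
        \<le> measure_pmf.prob M {T. \<forall>i\<in>A \<sigma> \<union> A \<tau>. T i = b i}"
      by (intro measure_pmf.finite_measure_mono) (auto simp: X_def b_def)
    also have "\<dots> = (1/2) ^ card (A \<sigma> \<union> A \<tau>)"
      unfolding M_def using AI by (intro prob_coin_cylinder finI) auto
    also have "\<dots> = 2 ^ k * ((1/2) ^ card (A \<sigma> \<union> A \<tau>) * (1/2) ^ k)"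
      by (simp add: power_one_over)
    also have "\<dots> = 2 ^ k * (1/4) ^ n"
      unfolding power_add[symmetric] card_Un power_mult by (simp add: power2_eq_square)
    also have "\<dots> \<le> 2 * (2 ^ k - 1) * (1/4) ^ n"
    proof (intro mult_right_mono)
      have "2 ^ 1 \<le> (2 ^ k :: real)"
        using \<open>k > 0\<close> by (intro power_increasing) auto
      thus "2 ^ k \<le> 2 * (2 ^ k - 1 :: real)"
        by simp
    qed simp
    finally show ?thesis
      unfolding k .
  next
    case False
    then obtain v where v: "v \<in> F (D \<sigma> \<tau>)" "v \<in> D \<sigma> \<tau>"
      by blast
    \<comment> \<open>Player \<open>v\<close> sees the same neighbour strategies in both profiles
      but plays differently, so one entry would have to take both values.\<close>
    have "(v, restrict \<sigma> (N v)) \<in> A \<sigma> \<inter> A \<tau>"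
      unfolding A_Int using v(1) by blast
    hence "\<not> (X \<sigma> T \<and> X \<tau> T)" for T
      using v(2) unfolding X_def a_def D_def by force
    hence "{T. X \<sigma> T \<and> X \<tau> T} = {}"
      by blast
    hence "measure_pmf.prob M {T. X \<sigma> T \<and> X \<tau> T} = 0"
      by (simp only: measure_empty)
    also have "0 \<le> 2 * (2 ^ card (F (D \<sigma> \<tau>) - D \<sigma> \<tau>) - 1) * (1/4 :: real) ^ n"
      by (intro mult_nonneg_nonneg) auto
    finally show ?thesis .
  qed
  have sum_profiles_const: "(\<Sum>\<sigma>\<in>profiles V. (1/4) ^ n * s) = s / 2 ^ n" for s :: real
  proof -
    have "(1/4 :: real) ^ n = 1 / (2 ^ n * 2 ^ n)"
      by (simp add: power_one_over flip: power_mult_distrib)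
    thus ?thesis
      by (simp add: card_profiles[OF V(1)] n_def)
  qed
  have num: "num_pne_pmf V E = map_pmf (\<lambda>T. card {\<sigma> \<in> profiles V. X \<sigma> T}) M"
    unfolding num_pne_pmf_def game_pmf_def M_def I_def N_def pmf.map_comp
    by (intro map_pmf_cong refl)
       (auto simp: pure_nash_equilibria_def X_def A_def a_def N_def intro!: arg_cong[where f = card])
  have "tv_dist (num_pne_pmf V E) (poisson_pmf 1)
    \<le> 12 * ((\<Sum>\<sigma>\<in>profiles V. \<Sum>\<tau>\<in>B \<sigma>. measure_pmf.prob M {w. X \<sigma> w} * measure_pmf.prob M {w. X \<tau> w}) +
            (\<Sum>\<sigma>\<in>profiles V. \<Sum>\<tau>\<in>B \<sigma> - {\<sigma>}. measure_pmf.prob M {w. X \<sigma> w \<and> X \<tau> w}))"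
    unfolding num
  proof (rule chen_stein_poisson_1)
    show "finite (set_pmf M)"
      unfolding M_def by (rule finite_set_Pi_coin[OF finI])
    show "finite (profiles V)"
      by (rule finite_profiles[OF V(1)])
    show "B \<sigma> \<subseteq> profiles V" for \<sigma>
      by (auto simp: B_def)
    show "(\<Sum>\<sigma>\<in>profiles V. measure_pmf.prob M {w. X \<sigma> w}) = 1"
      by (simp add: prob_X card_profiles[OF V(1)] n_def power_one_over)
    show "\<sigma> \<in> B \<sigma>" if "\<sigma> \<in> profiles V" for \<sigma>
      using that V(2) by (auto simp: B_def A_def)
    fix \<sigma> and g :: "nat \<Rightarrow> real"
    assume "\<sigma> \<in> profiles V"
    have "g (card {\<tau> \<in> profiles V - B \<sigma>. X \<tau> T}) = g (card {\<tau> \<in> profiles V - B \<sigma>. X \<tau> T'})"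
      if TT: "\<And>i. i \<in> I - A \<sigma> \<Longrightarrow> T i = T' i" for T T'
    proof -
      have "X \<tau> T = X \<tau> T'" if "\<tau> \<in> profiles V - B \<sigma>" for \<tau>
      proof -
        have "T i = T' i" if "i \<in> A \<tau>" for i
          using that AI[of \<tau>] \<open>\<tau> \<in> profiles V - B \<sigma>\<close> by (intro TT) (auto simp: B_def)
        thus ?thesis
          by (simp add: X_def)
      qed
      hence "{\<tau> \<in> profiles V - B \<sigma>. X \<tau> T} = {\<tau> \<in> profiles V - B \<sigma>. X \<tau> T'}"
        by blast
      thus ?thesis
        by simp
    qed
    hence "measure_pmf.expectation M (\<lambda>T. of_bool (\<forall>i\<in>A \<sigma>. T i = a \<sigma> i) * g (card {\<tau> \<in> profiles V - B \<sigma>. X \<tau> T}))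
      = (1/2) ^ card (A \<sigma>) * measure_pmf.expectation M (\<lambda>T. g (card {\<tau> \<in> profiles V - B \<sigma>. X \<tau> T}))"
      unfolding M_def by (rule coin_cylinder[OF finI AI])
    thus "measure_pmf.expectation M (\<lambda>T. of_bool (X \<sigma> T) * g (card {\<tau> \<in> profiles V - B \<sigma>. X \<tau> T})) =
      measure_pmf.prob M {T. X \<sigma> T} * measure_pmf.expectation M (\<lambda>T. g (card {\<tau> \<in> profiles V - B \<sigma>. X \<tau> T}))"
      by (simp add: prob_X cardA flip: X_def)
  qed
  also have "(\<Sum>\<sigma>\<in>profiles V. \<Sum>\<tau>\<in>B \<sigma>. measure_pmf.prob M {w. X \<sigma> w} * measure_pmf.prob M {w. X \<tau> w})
      = (\<Sum>x\<in>Pow V. of_bool (F x \<noteq> {})) / 2 ^ n"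
  proof -
    have "(\<Sum>\<tau>\<in>B \<sigma>. measure_pmf.prob M {w. X \<sigma> w} * measure_pmf.prob M {w. X \<tau> w})
      = (1/4) ^ n * (\<Sum>x\<in>Pow V. of_bool (F x \<noteq> {}))" if "\<sigma> \<in> profiles V" for \<sigma>
    proof -
      have "(\<Sum>x\<in>Pow V. of_bool (F x \<noteq> {}) :: real) = (\<Sum>\<tau>\<in>profiles V. of_bool (F (D \<sigma> \<tau>) \<noteq> {}))"
        unfolding D_def by (rule sum.reindex_bij_betw[OF bij_betw_profiles_Pow[OF that], symmetric])
      also have "\<dots> = (\<Sum>\<tau>\<in>B \<sigma>. 1)"
        using finite_profiles[OF V(1)] by (intro sum.mono_neutral_cong_right) (auto simp: B_iff)
      finally show ?thesis
        by (simp add: prob_X power_mult_distrib[symmetric])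
    qed
    hence "(\<Sum>\<sigma>\<in>profiles V. \<Sum>\<tau>\<in>B \<sigma>. measure_pmf.prob M {w. X \<sigma> w} * measure_pmf.prob M {w. X \<tau> w})
      = (\<Sum>\<sigma>\<in>profiles V. (1/4) ^ n * (\<Sum>x\<in>Pow V. of_bool (F x \<noteq> {})))"
      by (intro sum.cong refl)
    thus ?thesis
      by (simp only: sum_profiles_const)
  qed
  also have "(\<Sum>\<sigma>\<in>profiles V. \<Sum>\<tau>\<in>B \<sigma> - {\<sigma>}. measure_pmf.prob M {w. X \<sigma> w \<and> X \<tau> w})
      \<le> (\<Sum>x\<in>Pow V - {{}}. 2 * (2 ^ card (F x - x) - 1)) / 2 ^ n"
  proof -
    have "(\<Sum>\<tau>\<in>B \<sigma> - {\<sigma>}. measure_pmf.prob M {w. X \<sigma> w \<and> X \<tau> w})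
      \<le> (1/4) ^ n * (\<Sum>x\<in>Pow V - {{}}. 2 * (2 ^ card (F x - x) - 1))" if \<sigma>: "\<sigma> \<in> profiles V" for \<sigma>
    proof -
      have bij: "bij_betw (D \<sigma>) (profiles V - {\<sigma>}) (Pow V - {{}})"
        using bij_betw_DiffI[OF bij_betw_profiles_Pow[OF \<sigma>], of "{\<sigma>}" "{{}}"] \<sigma>
        by (simp add: D_def[abs_def] bij_betw_def)
      have "(\<Sum>\<tau>\<in>B \<sigma> - {\<sigma>}. measure_pmf.prob M {w. X \<sigma> w \<and> X \<tau> w})
        \<le> (\<Sum>\<tau>\<in>B \<sigma> - {\<sigma>}. 2 * (2 ^ card (F (D \<sigma> \<tau>) - D \<sigma> \<tau>) - 1) * (1/4) ^ n)"
        by (intro sum_mono prob_XX) auto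
      also have "\<dots> \<le> (\<Sum>\<tau>\<in>profiles V - {\<sigma>}. 2 * (2 ^ card (F (D \<sigma> \<tau>) - D \<sigma> \<tau>) - 1) * (1/4) ^ n)"
        using finite_profiles[OF V(1)] by (intro sum_mono2) (auto simp: B_def)
      also have "\<dots> = (\<Sum>x\<in>Pow V - {{}}. 2 * (2 ^ card (F x - x) - 1) * (1/4) ^ n)"
        by (rule sum.reindex_bij_betw[OF bij])
      finally show ?thesis
        by (simp add: sum_distrib_left mult.commute)
    qed
    hence "(\<Sum>\<sigma>\<in>profiles V. \<Sum>\<tau>\<in>B \<sigma> - {\<sigma>}. measure_pmf.prob M {w. X \<sigma> w \<and> X \<tau> w})
      \<le> (\<Sum>\<sigma>\<in>profiles V. (1/4) ^ n * (\<Sum>x\<in>Pow V - {{}}. 2 * (2 ^ card (F x - x) - 1)))"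
      by (intro sum_mono)
    also have "\<dots> = (\<Sum>x\<in>Pow V - {{}}. 2 * (2 ^ card (F x - x) - 1)) / 2 ^ n"
      by (rule sum_profiles_const)
    finally show ?thesis .
  qed
  finally show ?thesis
    by (simp add: pne_error_def F_def n_def add_divide_distrib)
qed

section \<open>Averaging over the random graph\<close>

lemma sum_Pow_power:
  fixes r :: real
  assumes "finite A"
  shows "(\<Sum>x\<in>Pow A. r ^ card x) = (1 + r) ^ card A"
  using prod_add[OF assms, of "\<lambda>_. r" "\<lambda>_. 1"] by (simp add: add.commute)

text \<open>Toggling \<open>v\<close> does not change the term, so each subset of
  \<open>A - {v}\<close> is counted twice.\<close>

lemma sum_Pow_power_remove:
  fixes r :: real
  assumes "finite A" "v \<in> A"
  shows "(\<Sum>x\<in>Pow A. r ^ card (x - {v})) = 2 * (1 + r) ^ (card A - 1)"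
proof -
  define A' where "A' = A - {v}"
  have A: "A = insert v A'" "v \<notin> A'" "finite A'" "card A' = card A - 1"
    using assms by (auto simp: A'_def)
  have "(\<Sum>x\<in>Pow A. r ^ card (x - {v})) =
      (\<Sum>x\<in>Pow A'. r ^ card (x - {v})) + (\<Sum>x\<in>insert v ` Pow A'. r ^ card (x - {v}))"
    unfolding A(1) Pow_insert using A(2,3) by (intro sum.union_disjoint) auto
  also have "(\<Sum>x\<in>insert v ` Pow A'. r ^ card (x - {v})) = (\<Sum>x\<in>Pow A'. r ^ card (insert v x - {v}))"
    using A(2) by (subst sum.reindex) (auto simp: inj_on_def)
  also have "\<dots> = (\<Sum>x\<in>Pow A'. r ^ card x)"
    using A(2) by (intro sum.cong refl arg_cong[where f = "\<lambda>y. r ^ card y"]) auto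
  also have "(\<Sum>x\<in>Pow A'. r ^ card (x - {v})) = (\<Sum>x\<in>Pow A'. r ^ card x)"
    using A(2) by (intro sum.cong refl arg_cong[where f = "\<lambda>y. r ^ card y"]) auto
  finally show ?thesis
    using sum_Pow_power[OF A(3), of r] A(4) by simp
qed

section \<open>Absent edges in the random graph\<close>

lemma finite_all_edges: "finite V \<Longrightarrow> finite (all_edges V)"
  by (rule finite_subset[of _ "Pow V"]) (auto simp: all_edges_def)

lemma finite_set_erdos_renyi: "finite (set_pmf (erdos_renyi_pmf n p))"
  unfolding erdos_renyi_pmf_def
  by (subst set_map_pmf) (auto intro!: finite_imageI simp: set_Pi_pmf finite_all_edges)

lemma prob_erdos_renyi_no_edges:
  assumes p: "0 \<le> p" "p \<le> 1" and F: "F \<subseteq> all_edges {..<n}"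
  shows "measure_pmf.prob (erdos_renyi_pmf n p) {E. E \<inter> F = {}} = (1 - p) ^ card F"
proof -
  define A where "A = all_edges {..<n}"
  have fin: "finite A"
    by (simp add: A_def finite_all_edges)
  have "measure_pmf.prob (erdos_renyi_pmf n p) {E. E \<inter> F = {}} =
      measure_pmf.prob (Pi_pmf A False (\<lambda>_. bernoulli_pmf p)) (Pi A (\<lambda>e. if e \<in> F then {False} else UNIV))"
    unfolding erdos_renyi_pmf_def A_def[symmetric] measure_map_pmf using F
    by (intro arg_cong[where f = "measure_pmf.prob _"]) (auto simp: A_def split: if_splits)
  also have "\<dots> = (\<Prod>e\<in>A. if e \<in> F then 1 - p else 1)"
    unfolding measure_Pi_pmf_Pi[OF fin]
    using p by (intro prod.cong refl) (simp add: measure_pmf_single)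
  also have "\<dots> = (\<Prod>e\<in>F. 1 - p)"
    using F fin by (intro prod.mono_neutral_cong_right) (auto simp: A_def)
  finally show ?thesis
    by simp
qed

lemma prob_mem_isolated_from_le:
  assumes p: "0 \<le> p" "p \<le> 1" and v: "v < n" and x: "x \<subseteq> {..<n}"
  shows "measure_pmf.prob (erdos_renyi_pmf n p) {E. v \<in> isolated_from {..<n} E x}
    \<le> (1 - p) ^ card (x - {v})"
proof -
  define F where "F = (\<lambda>w. {v, w}) ` (x - {v})"
  have "card F = card (x - {v})"
    unfolding F_def by (intro card_image) (auto simp: inj_on_def doubleton_eq_iff)
  moreover have F: "F \<subseteq> all_edges {..<n}"
    using v x by (auto simp: F_def all_edges_def)
  moreover have "measure_pmf.prob (erdos_renyi_pmf n p) {E. v \<in> isolated_from {..<n} E x}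
      \<le> measure_pmf.prob (erdos_renyi_pmf n p) {E. E \<inter> F = {}}"
    using x by (intro measure_pmf.finite_measure_mono)
      (auto simp: F_def isolated_from_def neighbours_def)
  ultimately show ?thesis
    using prob_erdos_renyi_no_edges[OF p F] by simp
qed

text \<open>As \<open>T\<close> is disjoint from \<open>x\<close>, the pairs in
  \<open>T \<times> x\<close> are distinct edges and the exponents multiply; inside \<open>x\<close>
  an edge could be counted from both ends.\<close>

lemma prob_subset_isolated_from:
  assumes p: "0 \<le> p" "p \<le> 1" and x: "x \<subseteq> {..<n}" and T: "T \<subseteq> {..<n} - x"
  shows "measure_pmf.prob (erdos_renyi_pmf n p) {E. T \<subseteq> isolated_from {..<n} E x}
    = ((1 - p) ^ card x) ^ card T"
proof -
  define F where "F = (\<lambda>(v, w). {v, w}) ` (T \<times> x)"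
  have "card F = card (T \<times> x)"
    unfolding F_def using T by (intro card_image) (auto simp: inj_on_def doubleton_eq_iff)
  moreover have F: "F \<subseteq> all_edges {..<n}"
    using T x by (auto simp: F_def all_edges_def card_insert_if)
  moreover have "{E. T \<subseteq> isolated_from {..<n} E x} = {E. E \<inter> F = {}}"
    using x T by (auto simp: F_def isolated_from_def neighbours_def)
  ultimately show ?thesis
    using prob_erdos_renyi_no_edges[OF p F] by (simp add: card_cartesian_product mult.commute flip: power_mult)
qed

text \<open>\<open>2 ^ card S\<close> counts the subsets of \<open>S\<close>, which turns the
  expectation into a sum of probabilities. Probabilistically, players outside \<open>x\<close> are
  isolated from it independently, each with probability \<open>(1 - p) ^ card x\<close>.\<close>

lemma expectation_two_power_isolated_from:
  assumes p: "0 \<le> p" "p \<le> 1" and x: "x \<subseteq> {..<n}"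
  shows "measure_pmf.expectation (erdos_renyi_pmf n p) (\<lambda>E. 2 ^ card (isolated_from {..<n} E x - x))
    = (1 + (1 - p) ^ card x) ^ (n - card x)"
proof -
  define V where "V = {..<n}"
  have "2 ^ card (isolated_from V E x - x) = (\<Sum>T\<in>Pow (V - x). of_bool (T \<subseteq> isolated_from V E x) :: real)" for E
  proof -
    define S where "S = isolated_from V E x - x"
    have S: "S \<subseteq> V - x" "finite S"
      by (auto simp: S_def isolated_from_def V_def)
    have "2 ^ card S = (\<Sum>T\<in>Pow S. 1 :: real)"
      using S(2) by (simp add: card_Pow)
    also have "\<dots> = (\<Sum>T\<in>Pow (V - x). of_bool (T \<subseteq> isolated_from V E x))"
      using S(1) by (intro sum.mono_neutral_cong_left) (auto simp: S_def V_def)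
    finally show ?thesis
      by (simp add: S_def)
  qed
  hence "measure_pmf.expectation (erdos_renyi_pmf n p) (\<lambda>E. 2 ^ card (isolated_from V E x - x))
    = (\<Sum>T\<in>Pow (V - x). measure_pmf.prob (erdos_renyi_pmf n p) {E. T \<subseteq> isolated_from V E x})"
    by (simp add: Bochner_Integration.integral_sum integrable_measure_pmf_finite
        finite_set_erdos_renyi expectation_of_bool)
  also have "\<dots> = (\<Sum>T\<in>Pow (V - x). ((1 - p) ^ card x) ^ card T)"
    using prob_subset_isolated_from[OF p x] by (intro sum.cong refl) (auto simp: V_def)
  also have "\<dots> = (1 + (1 - p) ^ card x) ^ card (V - x)"
    by (intro sum_Pow_power) (simp add: V_def)
  also have "card (V - x) = n - card x"
    using x by (simp add: V_def card_Diff_subset finite_subset)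
  finally show ?thesis
    unfolding V_def .
qed

text \<open>The first term is a union bound over players: for fixed \<open>v\<close> the sum over
  \<open>x\<close> is 2 (2 - p)^(n-1), and division by 2^n gives the power of 1 - p / 2. The second
  term uses the exact expectation.\<close>

lemma expectation_pne_error_le:
  assumes p: "0 \<le> p" "p \<le> 1" and n: "n > 0"
  shows "measure_pmf.expectation (erdos_renyi_pmf n p) (pne_error {..<n})
    \<le> real n * (1 - p / 2) ^ (n - 1) +
      2 * (\<Sum>x\<in>Pow {..<n} - {{}}. ((1 + (1 - p) ^ card x) ^ (n - card x) - 1) / 2 ^ n)"
proof -
  define V where "V = {..<n}"
  define G where "G = erdos_renyi_pmf n p"
  have int [simp]: "integrable (measure_pmf G) (u :: nat set set \<Rightarrow> real)" for u
    unfolding G_def by (rule integrable_measure_pmf_finite[OF finite_set_erdos_renyi])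
  have "measure_pmf.expectation G (\<lambda>E. of_bool (isolated_from V E x \<noteq> {})) \<le> (\<Sum>v\<in>V. (1 - p) ^ card (x - {v}))"
    if x: "x \<in> Pow V" for x
  proof -
    have "measure_pmf.expectation G (\<lambda>E. of_bool (isolated_from V E x \<noteq> {}) :: real)
        \<le> measure_pmf.expectation G (\<lambda>E. \<Sum>v\<in>V. of_bool (v \<in> isolated_from V E x))"
    proof (intro integral_mono int)
      fix E
      show "of_bool (isolated_from V E x \<noteq> {}) \<le> (\<Sum>v\<in>V. of_bool (v \<in> isolated_from V E x) :: real)"
      proof (cases "isolated_from V E x = {}")
        case False
        then obtain v where v: "v \<in> isolated_from V E x"
          by blast
        moreover have "v \<in> V"
          using v by (simp add: isolated_from_def)
        ultimately show ?thesis
          using member_le_sum[of v V "\<lambda>v. of_bool (v \<in> isolated_from V E x) :: real"]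
          by (simp add: V_def)
      qed (simp add: sum_nonneg)
    qed
    also have "\<dots> = (\<Sum>v\<in>V. measure_pmf.prob G {E. v \<in> isolated_from V E x})"
      by (simp add: Bochner_Integration.integral_sum expectation_of_bool)
    also have "\<dots> \<le> (\<Sum>v\<in>V. (1 - p) ^ card (x - {v}))"
      using x p prob_mem_isolated_from_le unfolding G_def V_def by (intro sum_mono) auto
    finally show ?thesis .
  qed
  hence "(\<Sum>x\<in>Pow V. measure_pmf.expectation G (\<lambda>E. of_bool (isolated_from V E x \<noteq> {})))
      \<le> (\<Sum>x\<in>Pow V. \<Sum>v\<in>V. (1 - p) ^ card (x - {v}))"
    by (rule sum_mono)
  also have "\<dots> = (\<Sum>v\<in>V. \<Sum>x\<in>Pow V. (1 - p) ^ card (x - {v}))"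
    by (rule sum.swap)
  also have "\<dots> = (\<Sum>v\<in>V. 2 * (1 + (1 - p)) ^ (card V - 1))"
    by (intro sum.cong refl sum_Pow_power_remove) (auto simp: V_def)
  also have "\<dots> = real n * (1 - p / 2) ^ (n - 1) * 2 ^ n"
  proof -
    have "2 * (2 - p) ^ (n - 1) = (1 - p / 2) ^ (n - 1) * (2 * 2 ^ (n - 1))"
      by (simp add: power_mult_distrib[symmetric] algebra_simps)
    thus ?thesis
      using n by (simp add: V_def power_Suc[symmetric] del: power_Suc)
  qed
  finally have 1: "(\<Sum>x\<in>Pow V. measure_pmf.expectation G (\<lambda>E. of_bool (isolated_from V E x \<noteq> {})))
      \<le> real n * (1 - p / 2) ^ (n - 1) * 2 ^ n" .
  have 2: "(\<Sum>x\<in>Pow V - {{}}. 2 * (measure_pmf.expectation G (\<lambda>E. 2 ^ card (isolated_from V E x - x)) - 1))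
      = 2 * (\<Sum>x\<in>Pow V - {{}}. ((1 + (1 - p) ^ card x) ^ (n - card x) - 1) / 2 ^ n) * 2 ^ n"
    unfolding sum_distrib_left sum_distrib_right
    using expectation_two_power_isolated_from[OF p]
    by (intro sum.cong refl) (auto simp: G_def V_def)
  have "measure_pmf.expectation G (pne_error V) =
     ((\<Sum>x\<in>Pow V. measure_pmf.expectation G (\<lambda>E. of_bool (isolated_from V E x \<noteq> {}))) +
     (\<Sum>x\<in>Pow V - {{}}. 2 * (measure_pmf.expectation G (\<lambda>E. 2 ^ card (isolated_from V E x - x)) - 1))) / 2 ^ n"
    unfolding pne_error_def[abs_def]
    by (simp add: Bochner_Integration.integral_sum Bochner_Integration.integral_add
        Bochner_Integration.integral_diff) (simp add: V_def)
  also have "\<dots> \<le> (real n * (1 - p / 2) ^ (n - 1) * 2 ^ n +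
      2 * (\<Sum>x\<in>Pow V - {{}}. ((1 + (1 - p) ^ card x) ^ (n - card x) - 1) / 2 ^ n) * 2 ^ n) / 2 ^ n"
    unfolding 2 using 1 by (intro divide_right_mono add_right_mono) auto
  also have "\<dots> = real n * (1 - p / 2) ^ (n - 1) +
      2 * (\<Sum>x\<in>Pow V - {{}}. ((1 + (1 - p) ^ card x) ^ (n - card x) - 1) / 2 ^ n)"
    by (simp add: add_divide_distrib)
  finally show ?thesis
    unfolding G_def V_def .
qed

section \<open>Asymptotic estimates\<close>

text \<open>The left side is the moment generating function of a fair bit, so this is Hoeffding's
  lemma; it is applied at + y and then multiplied by exp(- y).\<close>

lemma half_one_plus_exp_le:
  fixes y :: real
  assumes "0 \<le> y"
  shows "(1 + exp (- y)) / 2 \<le> exp (- y / 2 + y\<^sup>2 / 8)"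
proof -
  have eq: "1 + (1/2) * (exp y - 1) = (1 + exp y) / 2"
    by (simp add: field_simps)
  have "- y * (1/2) + ln (1 + (1/2) * (exp y - 1)) \<le> y\<^sup>2 / 8"
    using Hoeffdings_lemma_aux[of y "1/2"] assms by simp
  hence "ln ((1 + exp y) / 2) \<le> y / 2 + y\<^sup>2 / 8"
    unfolding eq by linarith
  hence "exp (ln ((1 + exp y) / 2)) \<le> exp (y / 2 + y\<^sup>2 / 8)"
    by (simp only: exp_le_cancel_iff)
  moreover have "exp (ln ((1 + exp y) / 2)) = (1 + exp y) / 2"
    by (intro exp_ln) (simp add: add_pos_pos)
  ultimately have "(1 + exp y) / 2 \<le> exp (y / 2 + y\<^sup>2 / 8)"
    by (simp only:)
  hence "exp (- y) * ((1 + exp y) / 2) \<le> exp (- y) * exp (y / 2 + y\<^sup>2 / 8)"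
    by simp
  thus ?thesis
    by (simp add: distrib_left flip: exp_add)
qed

lemma exp_le_one_plus_twice:
  fixes x :: real
  assumes "0 \<le> x" "x \<le> 1"
  shows "exp x \<le> 1 + 2 * x"
proof -
  have "x\<^sup>2 \<le> x"
    using assms by (simp add: power2_eq_square mult_left_le)
  thus ?thesis
    using exp_bound[of x] assms by linarith
qed

lemma one_plus_power_le_exp:
  fixes u :: real
  assumes "0 \<le> u"
  shows "(1 + u) ^ n \<le> exp (real n * u)"
  using power_mono[OF exp_ge_add_one_self, of u n] assms
  by (simp add: exp_of_nat_mult)

lemma one_minus_power_le_exp:
  fixes p :: real
  assumes "p \<le> 1"
  shows "(1 - p) ^ s \<le> exp (- p * real s)"
  using power_mono[OF exp_ge_add_one_self[of "- p"], of s] assms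
  by (simp add: exp_of_nat_mult[symmetric] mult.commute)

section \<open>Bounds on one term of the averaged error\<close>

definition isolation_excess :: "nat \<Rightarrow> real \<Rightarrow> nat \<Rightarrow> real" where
  "isolation_excess n p s = ((1 + (1 - p) ^ s) ^ (n - s) - 1) / 2 ^ n"

lemma isolation_excess_le:
  assumes p: "0 \<le> p" "p \<le> 1"
  shows "isolation_excess n p s \<le> ((1 + (1 - p) ^ s) ^ n - 1) / 2 ^ n"
  unfolding isolation_excess_def using p
  by (intro divide_right_mono diff_right_mono power_increasing) auto

text \<open>The subtracted 1 in the excess is decisive here: it leaves only the part linear in
  \<open>(1 - p) ^ s\<close>, whereas the 1 itself, summed over about 2^n sets, would contribute a
  constant.\<close>

lemma isolation_excess_le_large:
  assumes p: "0 \<le> p" "p \<le> 1" and s: "real n * exp (- p * real s) \<le> 1"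
  shows "isolation_excess n p s \<le> 2 * real n / 2 ^ n * (1 - p) ^ s"
proof -
  define r where "r = (1 - p) ^ s"
  have r: "0 \<le> r" "r \<le> exp (- p * real s)"
    using p one_minus_power_le_exp by (auto simp: r_def)
  have "real n * r \<le> real n * exp (- p * real s)"
    using r by (intro mult_left_mono) auto
  hence nr: "real n * r \<le> 1"
    using s by linarith
  have "(1 + r) ^ n \<le> exp (real n * r)"
    using r(1) by (rule one_plus_power_le_exp)
  also have "\<dots> \<le> 1 + 2 * (real n * r)"
    using nr r(1) by (intro exp_le_one_plus_twice) auto
  finally have "((1 + r) ^ n - 1) / 2 ^ n \<le> (2 * (real n * r)) / 2 ^ n"
    by (intro divide_right_mono) auto
  thus ?thesis
    using isolation_excess_le[OF p, of n s] by (simp add: r_def mult.assoc)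
qed

text \<open>The free parameter \<open>y\<close> serves two regimes: y = p s makes the bound
  geometric in \<open>s\<close>, and a \<open>y\<close> not depending on \<open>s\<close> gives a
  uniform bound.\<close>

lemma isolation_excess_le_exp:
  assumes p: "0 \<le> p" "p \<le> 1" and y: "0 \<le> y" "y \<le> p * real s"
  shows "isolation_excess n p s \<le> exp (real n * (- y / 2 + y\<^sup>2 / 8))"
proof -
  have "(1 - p) ^ s \<le> exp (- p * real s)"
    by (rule one_minus_power_le_exp[OF p(2)])
  also have "\<dots> \<le> exp (- y)"
    using y(2) by simp
  finally have "(1 + (1 - p) ^ s) / 2 \<le> exp (- y / 2 + y\<^sup>2 / 8)"
    using half_one_plus_exp_le[OF y(1)] by simp
  hence "((1 + (1 - p) ^ s) / 2) ^ n \<le> exp (- y / 2 + y\<^sup>2 / 8) ^ n"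
    using p by (intro power_mono) auto
  also have "\<dots> = exp (real n * (- y / 2 + y\<^sup>2 / 8))"
    by (rule exp_of_nat_mult[symmetric])
  also have "((1 + (1 - p) ^ s) / 2) ^ n = (1 + (1 - p) ^ s) ^ n / 2 ^ n"
    by (rule power_divide)
  finally show ?thesis
    using isolation_excess_le[OF p, of n s] by (simp add: diff_divide_distrib)
      (smt (verit) zero_less_power divide_pos_pos)
qed

lemma isolation_excess_le_middle:
  assumes p: "0 \<le> p" "p \<le> 1" and y: "y \<le> p * real s"
  shows "isolation_excess n p s \<le> exp (real n * exp (- y)) / 2 ^ n"
proof -
  have r0: "0 \<le> (1 - p) ^ s"
    using p by simp
  have "(1 - p) ^ s \<le> exp (- p * real s)"
    by (rule one_minus_power_le_exp[OF p(2)])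
  also have "\<dots> \<le> exp (- y)"
    using y by simp
  finally have "exp (real n * (1 - p) ^ s) \<le> exp (real n * exp (- y))"
    by (simp add: mult_left_mono)
  hence "(1 + (1 - p) ^ s) ^ n - 1 \<le> exp (real n * exp (- y))"
    using one_plus_power_le_exp[OF r0, of n] by linarith
  thus ?thesis
    using isolation_excess_le[OF p, of n s] divide_right_mono[of _ _ "2 ^ n :: real"]
    by (meson order.trans zero_le_numeral zero_le_power)
qed

text \<open>The power of n is o(n), so the linear term beats any polynomial factor. The exponent 1 /
  (4 \<alpha>) is chosen for use with \<epsilon> < 1 / \<alpha>, where it exceeds \<epsilon> / 4;
  \<open>K\<close> then does not depend on \<epsilon>.\<close>

lemma exp_powr_diff_bounded:
  fixes \<alpha> \<gamma> :: real
  assumes "0 < \<alpha>" "\<alpha> < 1/2" "0 < \<gamma>"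
  obtains K where "0 < K"
    "\<And>n. exp (real n powr (1 - 2 * \<alpha>) - \<gamma> * real n) \<le> K * exp (- ln (real n) / (4 * \<alpha>))"
proof -
  define f where "f n = exp (real n powr (1 - 2 * \<alpha>) - \<gamma> * real n + ln (real n) / (4 * \<alpha>))" for n :: nat
  have "f \<longlonglongrightarrow> 0"
    unfolding f_def using assms by real_asymp
  hence "Bseq f"
    using convergent_imp_Bseq convergentI by blast
  then obtain K where K: "0 < K" "\<And>n. norm (f n) \<le> K"
    using BseqE by blast
  have "exp (real n powr (1 - 2 * \<alpha>) - \<gamma> * real n) \<le> K * exp (- ln (real n) / (4 * \<alpha>))" for n
  proof -
    have "exp (real n powr (1 - 2 * \<alpha>) - \<gamma> * real n) = f n * exp (- ln (real n) / (4 * \<alpha>))"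
      by (simp add: f_def flip: exp_add)
    thus ?thesis
      using K(2)[of n] by (simp add: mult_right_mono)
  qed
  thus ?thesis
    using that K(1) by blast
qed

text \<open>The sum is split according to the size \<open>s\<close> of \<open>x\<close>: for \<open>p s \<le> \<eta>\<close> the summand is at most
  geometric in \<open>s\<close>; for \<open>\<eta> < p s\<close> and \<open>s \<le> \<alpha> n\<close> there are few sets \<open>x\<close>; for \<open>\<alpha> n < s\<close> and
  \<open>n exp(- p s) > 1\<close> the parameter \<open>\<epsilon>\<close> is bounded and \<open>s\<close> is so far below \<open>n/2\<close> that a Chernoff
  bound wins; and for \<open>n exp(- p s) \<le> 1\<close> the excess is linear in \<open>(1 - p) ^ s\<close>.\<close>

lemma sum_isolation_excess_le:
  fixes c :: real
  assumes c: "c > 0"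
  obtains K where "K > 0"
    "\<And>n \<epsilon> p. n \<ge> 2 \<Longrightarrow> c < \<epsilon> \<Longrightarrow> p * real n = (2 + \<epsilon>) * ln (real n) \<Longrightarrow> p \<le> 1 \<Longrightarrow>
       (\<Sum>x\<in>Pow {..<n} - {{}}. isolation_excess n p (card x)) \<le> K * exp (- \<epsilon> * ln (real n) / 4)"
proof -
  \<comment> \<open>Since 2 x / (2 + x) increases in x, this ensures (2 + \<epsilon>) \<eta> <= 2
    \<epsilon> for every \<epsilon> > c, so the quadratic term in Hoeffding's bound costs at most
    half of the exponent \<epsilon> / 2.\<close>
  define \<eta> where "\<eta> = min 1 (2 * c / (2 + c))"
  \<comment> \<open>\<open>t\<close> is the exponential tilt for counting sets of size at most
    \<alpha> n. Both exp(- t) and t \<alpha> equal \<eta> / 32, so the count costs \<eta> n / 16 in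
    the exponent, well below the gain 3 \<eta> n / 8.\<close>
  define t where "t = ln (32 / \<eta>)"
  define \<alpha> where "\<alpha> = \<eta> / (32 * t)"
  \<comment> \<open>p s < ln n forces s < n / (2 + \<epsilon>), hence s <= \<beta> n with \<beta> <
    1/2. The tilt \<tau> minimizes \<tau> \<beta> - \<tau> / 2 + \<tau>^2 / 8, and the minimum is -
    \<gamma>.\<close>
  define \<beta> where "\<beta> = 1 / (2 + c)"
  define \<tau> where "\<tau> = 4 * (1/2 - \<beta>)"
  define \<gamma> where "\<gamma> = 2 * (1/2 - \<beta>)\<^sup>2"
  have \<eta>: "0 < \<eta>" "\<eta> \<le> 1" "\<eta> \<le> 2 * c / (2 + c)"
    using c by (auto simp: \<eta>_def)
  have "exp 1 \<le> 32 / \<eta>"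
    using \<eta> exp_le by (simp add: pos_le_divide_eq)
       (smt (verit) mult_left_le exp_gt_zero)
  hence t: "1 \<le> t" "exp (- t) = \<eta> / 32"
    using \<eta> by (auto simp: t_def ln_ge_iff exp_minus)
  have \<alpha>: "0 < \<alpha>" "\<alpha> < 1/2" "t * \<alpha> = \<eta> / 32"
    using \<eta> t(1) by (auto simp: \<alpha>_def pos_divide_less_eq)
  have \<beta>: "0 < \<beta>" "\<beta> < 1/2"
    using c by (auto simp: \<beta>_def)
  have \<tau>: "0 < \<tau>" "\<tau> * \<beta> + (- \<tau> / 2 + \<tau>\<^sup>2 / 8) = - \<gamma>"
    using \<beta> by (auto simp: \<tau>_def \<gamma>_def power2_eq_square field_simps)
  have \<gamma>: "0 < \<gamma>"
    using \<beta> by (simp add: \<gamma>_def)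
  obtain K where K: "0 < K"
    "\<And>n. exp (real n powr (1 - 2 * \<alpha>) - \<gamma> * real n) \<le> K * exp (- ln (real n) / (4 * \<alpha>))"
    using exp_powr_diff_bounded[OF \<alpha>(1,2) \<gamma>] by blast
  have "(\<Sum>x\<in>Pow {..<n} - {{}}. isolation_excess n p (card x)) \<le> (5 + K) * exp (- \<epsilon> * ln (real n) / 4)"
    if n: "n \<ge> 2" and \<epsilon>: "c < \<epsilon>" and pn: "p * real n = (2 + \<epsilon>) * ln (real n)" and p1: "p \<le> 1"
    for n \<epsilon> p
  proof -
    define L where "L = ln (real n)"
    \<comment> \<open>q >= \<eta> pays for the number of sets, and q >= p keeps the decay uniform in
      \<epsilon>. In the second range q <= p s because s >= 1.\<close>
    define q where "q = max p \<eta>"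
    define u where "u = exp (p * real n * (- 1/2 + \<eta> / 8))"
    define P where "P = Pow {..<n} - {{}}"
    define gA where "gA s = u ^ s" for s
    define gB where "gB s = exp (- 3 * q * real n / 8) * (exp (t * \<alpha> * real n) * exp (- t) ^ s)" for s
    \<comment> \<open>The third range is empty once \<epsilon> >= 1 / \<alpha>. The cutoff matters
      because a fixed power of n cannot follow a growing \<epsilon>.\<close>
    define gC where "gC s = (if \<epsilon> < 1 / \<alpha> then
        exp (real n powr (1 - 2 * \<alpha>)) / 2 ^ n * (exp (\<tau> * \<beta> * real n) * exp (- \<tau>) ^ s) else 0)" for s
    define gD where "gD s = 2 * real n / 2 ^ n * (1 - p) ^ s" for s
    have L: "0 < L" "exp L = real n"
      using n by (auto simp: L_def)
    have n0: "0 < real n"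
      using n by simp
    have p0: "0 < p"
    proof -
      have "0 < p * real n"
        unfolding pn using \<epsilon> c L by (simp add: L_def)
      thus ?thesis
        using n0 by (simp add: zero_less_mult_iff)
    qed
    have q: "p \<le> q" "\<eta> \<le> q" "0 < q" "q \<le> 1"
      using p0 p1 \<eta> by (auto simp: q_def)
    have g_nonneg: "0 \<le> gA s" "0 \<le> gB s" "0 \<le> gC s" "0 \<le> gD s" for s
      using p1 by (auto simp: gA_def gB_def gC_def gD_def u_def)
    have finP: "finite P"
      by (simp add: P_def)
    have sum_P: "(\<Sum>x\<in>P. v ^ card x) \<le> exp (real n * v) - 1" if "0 \<le> v" for v :: real
    proof -
      have "(\<Sum>x\<in>P. v ^ card x) = (1 + v) ^ n - 1"
        using sum_Pow_power[of "{..<n}" v] by (simp add: P_def sum_diff1)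
      thus ?thesis
        using one_plus_power_le_exp[OF that, of n] by simp
    qed
    have sum_P': "(\<Sum>x\<in>P. v ^ card x) \<le> (1 + v) ^ n" if "0 \<le> v" for v :: real
      using sum_Pow_power[of "{..<n}" v] by (simp add: P_def sum_diff1)

    have pointwise: "isolation_excess n p s \<le> gA s + gB s + gC s + gD s" if s: "s \<ge> 1" for s
    proof -
      have ps: "p \<le> p * real s" "0 \<le> p * real s"
        using s p0 by auto
      consider "p * real s \<le> \<eta>" | "\<eta> < p * real s" "real s \<le> \<alpha> * real n"
        | "\<alpha> * real n < real s" "p * real s < L" | "L \<le> p * real s"
        by linarith
      thus ?thesis
      proof cases
        case 1
        have "isolation_excess n p s \<le> exp (real n * (- (p * real s) / 2 + (p * real s)\<^sup>2 / 8))"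
          using p0 p1 ps by (intro isolation_excess_le_exp) auto
        also have "\<dots> \<le> exp (real s * (p * real n * (- 1/2 + \<eta> / 8)))"
        proof -
          have "(p * real s)\<^sup>2 \<le> p * real s * \<eta>"
            unfolding power2_eq_square using 1 ps by (intro mult_left_mono) auto
          hence "real n * (- (p * real s) / 2 + (p * real s)\<^sup>2 / 8)
              \<le> real n * (- (p * real s) / 2 + p * real s * \<eta> / 8)"
            by (intro mult_left_mono) auto
          also have "\<dots> = real s * (p * real n * (- 1/2 + \<eta> / 8))"
            by (simp add: algebra_simps)
          finally show ?thesis
            by simp
        qed
        also have "\<dots> = gA s"
          by (simp only: gA_def u_def exp_of_nat_mult)
        finally show ?thesis
          using g_nonneg[of s] by linarith
      next
        case 2
        have "isolation_excess n p s \<le> exp (real n * (- q / 2 + q\<^sup>2 / 8))"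
          using p0 p1 ps 2(1) q by (intro isolation_excess_le_exp) (auto simp: q_def)
        also have "\<dots> \<le> exp (- 3 * q * real n / 8)"
        proof -
          have "q\<^sup>2 \<le> q"
            using q by (simp add: power2_eq_square mult_left_le)
          hence "real n * (- q / 2 + q\<^sup>2 / 8) \<le> real n * (- 3 * q / 8)"
            by (intro mult_left_mono) auto
          thus ?thesis
            by (simp add: mult_ac)
        qed
        \<comment> \<open>The added weight is at least 1 in this range and allows the sum to run
          over all sets.\<close>
        also have "\<dots> \<le> exp (- 3 * q * real n / 8) * exp (t * (\<alpha> * real n - real s))"
          using 2(2) t(1) by simp
        also have "\<dots> = gB s"
          by (simp add: gB_def exp_of_nat_mult[symmetric] algebra_simps flip: exp_add)
        finally show ?thesis
          using g_nonneg[of s] by linarith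
      next
        case 3
        \<comment> \<open>\<open>s\<close> is squeezed between \<alpha> n and n / (2 + \<epsilon>),
          which bounds \<epsilon>.\<close>
        have "(2 + \<epsilon>) * L * real s < L * real n"
        proof -
          have "(2 + \<epsilon>) * L * real s = p * real s * real n"
            using pn by (simp add: L_def mult_ac)
          also have "\<dots> < L * real n"
            using 3(2) n0 by (intro mult_strict_right_mono) auto
          finally show ?thesis .
        qed
        hence s2: "(2 + \<epsilon>) * real s < real n"
          using L(1) by (metis mult.assoc mult.commute mult_less_cancel_left_pos)
        have "(2 + \<epsilon>) * (\<alpha> * real n) < (2 + \<epsilon>) * real s"
          using 3(1) \<epsilon> c by (intro mult_strict_left_mono) auto
        hence "(2 + \<epsilon>) * \<alpha> * real n < 1 * real n"
          using s2 by (simp add: mult.assoc)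
        hence "(2 + \<epsilon>) * \<alpha> < 1"
          using n0 mult_less_cancel_right_pos by blast
        hence \<epsilon>\<alpha>: "\<epsilon> < 1 / \<alpha>"
          using \<alpha>(1) by (simp add: pos_less_divide_eq algebra_simps)
        have "(2 + c) * real s \<le> (2 + \<epsilon>) * real s"
          using \<epsilon> by (intro mult_right_mono) auto
        hence s\<beta>: "real s \<le> \<beta> * real n"
          using s2 c by (simp add: \<beta>_def pos_le_divide_eq mult.commute)
        have "2 * \<alpha> * L \<le> (2 + \<epsilon>) * L * \<alpha>"
          using \<epsilon> c \<alpha>(1) L(1) by (simp add: algebra_simps)
        also have "\<dots> = p * (\<alpha> * real n)"
          using pn by (simp add: L_def mult_ac)
        also have "\<dots> \<le> p * real s"
          using 3(1) p0 by (intro mult_left_mono) auto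
        finally have "isolation_excess n p s \<le> exp (real n * exp (- (2 * \<alpha> * L))) / 2 ^ n"
          using p0 p1 by (intro isolation_excess_le_middle) auto
        also have "real n * exp (- (2 * \<alpha> * L)) = exp (L + - (2 * \<alpha> * L))"
          unfolding exp_add L(2) ..
        also have "\<dots> = real n powr (1 - 2 * \<alpha>)"
          using n0 by (simp add: powr_def L_def algebra_simps)
        also have "exp (real n powr (1 - 2 * \<alpha>)) / 2 ^ n
            \<le> exp (real n powr (1 - 2 * \<alpha>)) / 2 ^ n * exp (\<tau> * (\<beta> * real n - real s))"
        proof -
          have "exp (real n powr (1 - 2 * \<alpha>)) / 2 ^ n * 1
              \<le> exp (real n powr (1 - 2 * \<alpha>)) / 2 ^ n * exp (\<tau> * (\<beta> * real n - real s))"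
            using s\<beta> \<tau>(1) by (intro mult_left_mono) auto
          thus ?thesis
            by (simp only: mult_1_right)
        qed
        also have "exp (\<tau> * (\<beta> * real n - real s)) = exp (\<tau> * \<beta> * real n) * exp (- \<tau>) ^ s"
          by (simp add: exp_of_nat_mult[symmetric] algebra_simps flip: exp_add)
        also have "exp (real n powr (1 - 2 * \<alpha>)) / 2 ^ n * \<dots> = gC s"
          using \<epsilon>\<alpha> by (simp add: gC_def)
        finally show ?thesis
          using g_nonneg[of s] by linarith
      next
        case 4
        have "real n * exp (- p * real s) = exp (L - p * real s)"
          using L(2) by (simp add: exp_diff exp_minus field_simps)
        hence "isolation_excess n p s \<le> gD s"
          unfolding gD_def using 4 p0 p1 by (intro isolation_excess_le_large) auto
        thus ?thesis
          using g_nonneg[of s] by linarith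
      qed
    qed

    have mono\<epsilon>: "exp (- \<epsilon> * L / 2) \<le> exp (- \<epsilon> * L / 4)"
      using \<epsilon> c L by (simp add: field_simps)

    have A: "(\<Sum>x\<in>P. gA (card x)) \<le> 2 * exp (- \<epsilon> * L / 4)"
    proof -
      have "(2 + \<epsilon>) * \<eta> \<le> 2 * \<epsilon>"
      proof -
        have "2 * c / (2 + c) \<le> 2 * \<epsilon> / (2 + \<epsilon>)"
          using c \<epsilon> by (simp add: field_simps)
        hence "\<eta> \<le> 2 * \<epsilon> / (2 + \<epsilon>)"
          using \<eta>(3) by linarith
        thus ?thesis
          using c \<epsilon> by (simp add: pos_le_divide_eq mult.commute)
      qed
      hence "((2 + \<epsilon>) * \<eta>) * L \<le> (2 * \<epsilon>) * L"
        using L by (intro mult_right_mono) auto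
      moreover have "real n * u = exp (L + (2 + \<epsilon>) * L * (- 1/2 + \<eta> / 8))"
        unfolding exp_add u_def pn L(2) by (simp add: L_def)
      ultimately have nu: "real n * u \<le> exp (- \<epsilon> * L / 4)"
        by (simp add: algebra_simps)
      also have "\<dots> \<le> 1"
        using \<epsilon> c L by simp
      finally have "exp (real n * u) - 1 \<le> 2 * (real n * u)"
        using exp_le_one_plus_twice[of "real n * u"] by (simp add: u_def)
      thus ?thesis
        using sum_P[of u] nu by (simp add: gA_def u_def)
    qed

    have B: "(\<Sum>x\<in>P. gB (card x)) \<le> exp (- \<epsilon> * L / 4)"
    proof -
      have "(\<Sum>x\<in>P. gB (card x)) = exp (- 3 * q * real n / 8) * exp (t * \<alpha> * real n) * (\<Sum>x\<in>P. exp (- t) ^ card x)"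
        by (simp add: gB_def sum_distrib_left mult.assoc)
      also have "\<dots> \<le> exp (- 3 * q * real n / 8) * exp (t * \<alpha> * real n) * exp (real n * exp (- t))"
        using sum_P[of "exp (- t)"] by (intro mult_left_mono) auto
      also have "\<dots> = exp (- 3 * q * real n / 8 + \<eta> * real n / 16)"
        unfolding \<alpha>(3) t(2) by (simp add: field_simps flip: exp_add)
      also have "\<dots> \<le> exp (- (p * real n) / 4)"
      proof -
        have "\<eta> * real n \<le> q * real n" "p * real n \<le> q * real n" "0 \<le> q * real n"
          using q by (auto intro: mult_right_mono)
        thus ?thesis
          by (simp add: mult.assoc)
      qed
      also have "\<dots> \<le> exp (- \<epsilon> * L / 4)"
        unfolding pn using L by (simp add: L_def algebra_simps)
      finally show ?thesis .
    qed

    have C: "(\<Sum>x\<in>P. gC (card x)) \<le> K * exp (- \<epsilon> * L / 4)"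
    proof (cases "\<epsilon> < 1 / \<alpha>")
      case True
      have "(\<Sum>x\<in>P. gC (card x)) =
          exp (real n powr (1 - 2 * \<alpha>)) * exp (\<tau> * \<beta> * real n) * ((\<Sum>x\<in>P. exp (- \<tau>) ^ card x) / 2 ^ n)"
        using True by (simp add: gC_def sum_distrib_left sum_divide_distrib mult.assoc)
      also have "\<dots> \<le> exp (real n powr (1 - 2 * \<alpha>)) * exp (\<tau> * \<beta> * real n) * exp (real n * (- \<tau> / 2 + \<tau>\<^sup>2 / 8))"
      proof (intro mult_left_mono)
        have "(\<Sum>x\<in>P. exp (- \<tau>) ^ card x) / 2 ^ n \<le> (1 + exp (- \<tau>)) ^ n / 2 ^ n"
          using sum_P'[of "exp (- \<tau>)"] by (intro divide_right_mono) auto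
        also have "\<dots> = ((1 + exp (- \<tau>)) / 2) ^ n"
          by (simp add: power_divide)
        also have "\<dots> \<le> exp (- \<tau> / 2 + \<tau>\<^sup>2 / 8) ^ n"
          using \<tau>(1) by (intro power_mono half_one_plus_exp_le) (auto simp: add_nonneg_nonneg)
        finally show "(\<Sum>x\<in>P. exp (- \<tau>) ^ card x) / 2 ^ n \<le> exp (real n * (- \<tau> / 2 + \<tau>\<^sup>2 / 8))"
          by (simp only: exp_of_nat_mult)
      qed auto
      also have "\<dots> = exp (real n powr (1 - 2 * \<alpha>) + real n * (\<tau> * \<beta> + (- \<tau> / 2 + \<tau>\<^sup>2 / 8)))"
        by (simp only: distrib_left exp_add mult_ac)
      also have "\<dots> = exp (real n powr (1 - 2 * \<alpha>) - \<gamma> * real n)"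
        unfolding \<tau>(2) by (simp add: mult.commute)
      also have "\<dots> \<le> K * exp (- L / (4 * \<alpha>))"
        unfolding L_def by (rule K(2))
      also have "\<dots> \<le> K * exp (- \<epsilon> * L / 4)"
      proof -
        have "\<epsilon> * L \<le> 1 / \<alpha> * L"
          using True L by (intro mult_right_mono) auto
        thus ?thesis
          using K(1) by (simp add: mult.commute)
      qed
      finally show ?thesis .
    next
      case False
      thus ?thesis
        using K(1) by (simp add: gC_def)
    qed

    have D: "(\<Sum>x\<in>P. gD (card x)) \<le> 2 * exp (- \<epsilon> * L / 4)"
    proof -
      have "(\<Sum>x\<in>P. gD (card x)) = 2 * real n * ((\<Sum>x\<in>P. (1 - p) ^ card x) / 2 ^ n)"
        by (simp add: gD_def sum_distrib_left sum_divide_distrib)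
      also have "\<dots> \<le> 2 * real n * ((1 + (1 - p)) ^ n / 2 ^ n)"
        using sum_P'[of "1 - p"] p1 by (intro mult_left_mono divide_right_mono) auto
      also have "(1 + (1 - p)) ^ n / 2 ^ n = (1 - p / 2) ^ n"
        by (simp add: power_divide[symmetric] diff_divide_distrib)
      also have "2 * real n * \<dots> \<le> 2 * real n * exp (- (p / 2) * real n)"
        using p1 by (intro mult_left_mono one_minus_power_le_exp) auto
      also have "\<dots> = 2 * exp (L + - (p * real n) / 2)"
        unfolding exp_add L(2) by simp
      also have "\<dots> = 2 * exp (- \<epsilon> * L / 2)"
        unfolding pn by (simp add: L_def field_simps)
      finally show ?thesis
        using mono\<epsilon> by linarith
    qed

    have "(\<Sum>x\<in>P. isolation_excess n p (card x)) \<le> (\<Sum>x\<in>P. gA (card x) + gB (card x) + gC (card x) + gD (card x))"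
    proof (intro sum_mono pointwise)
      fix x assume "x \<in> P"
      thus "1 \<le> card x"
        using finite_subset[of x "{..<n}"] by (auto simp: P_def Suc_le_eq card_gt_0_iff)
    qed
    \<comment> \<open>The 5 is 2 + 1 + 2, from the first, second and fourth ranges.\<close>
    also have "\<dots> \<le> (5 + K) * exp (- \<epsilon> * L / 4)"
      using A B C D by (simp add: sum.distrib algebra_simps)
    finally show ?thesis
      unfolding P_def L_def .
  qed
  thus ?thesis
    using that[of "5 + K"] K(1) by simp
qed

section \<open>Convergence to the Poisson distribution\<close>

lemma expectation_pne_error_powr_le:
  fixes c :: real
  assumes c: "c > 0"
  obtains K where "K > 0"
    "\<And>n \<epsilon>. n \<ge> 2 \<Longrightarrow> c < \<epsilon> \<Longrightarrow> \<epsilon> \<le> real n / ln (real n) - 2 \<Longrightarrow>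
       measure_pmf.expectation (erdos_renyi_pmf n ((2 + \<epsilon>) * ln (real n) / real n)) (pne_error {..<n})
         \<le> K * real n powr (- \<epsilon> / 4)"
proof -
  obtain K where K: "K > 0"
    "\<And>n \<epsilon> p. n \<ge> 2 \<Longrightarrow> c < \<epsilon> \<Longrightarrow> p * real n = (2 + \<epsilon>) * ln (real n) \<Longrightarrow> p \<le> 1 \<Longrightarrow>
       (\<Sum>x\<in>Pow {..<n} - {{}}. isolation_excess n p (card x)) \<le> K * exp (- \<epsilon> * ln (real n) / 4)"
    using sum_isolation_excess_le[OF c] by blast
  have "measure_pmf.expectation (erdos_renyi_pmf n ((2 + \<epsilon>) * ln (real n) / real n)) (pne_error {..<n})
         \<le> (exp 1 + 2 * K) * real n powr (- \<epsilon> / 4)"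
    if n: "n \<ge> 2" and \<epsilon>: "c < \<epsilon>" "\<epsilon> \<le> real n / ln (real n) - 2" for n \<epsilon>
  proof -
    define L where "L = ln (real n)"
    define p where "p = (2 + \<epsilon>) * ln (real n) / real n"
    have L: "0 < L" "exp L = real n"
      using n by (auto simp: L_def)
    have n0: "0 < real n"
      using n by simp
    have p0: "0 \<le> p"
      using \<epsilon> c L by (simp add: p_def flip: L_def)
    have "2 + \<epsilon> \<le> real n / L"
      using \<epsilon>(2) by (simp add: L_def)
    hence "(2 + \<epsilon>) * L \<le> real n"
      using L(1) by (simp add: pos_le_divide_eq)
    hence p1: "p \<le> 1"
      using n0 by (simp add: p_def pos_divide_le_eq flip: L_def)
    have pn: "p * real n = (2 + \<epsilon>) * ln (real n)"
      using n0 by (simp add: p_def)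
    have powr: "real n powr (- \<epsilon> / 4) = exp (- \<epsilon> * L / 4)"
      using n0 by (simp add: powr_def L_def)
    have "real n * (1 - p / 2) ^ (n - 1) \<le> real n * exp (- (p / 2) * real (n - 1))"
      using p1 by (intro mult_left_mono one_minus_power_le_exp) auto
    also have "\<dots> = exp (L + - (p / 2) * real (n - 1))"
      unfolding exp_add L(2) ..
    \<comment> \<open>The exponent n - 1 in place of n costs exp(p / 2), which the factor
      \<open>exp 1\<close> absorbs.\<close>
    also have "\<dots> \<le> exp (1 + - \<epsilon> * L / 4)"
    proof -
      have "- (p / 2) * real (n - 1) = - (p * real n) / 2 + p / 2"
        using n by (simp add: of_nat_diff field_simps)
      also have "\<dots> = - L - \<epsilon> * L / 2 + p / 2"
        unfolding pn by (simp add: L_def field_simps)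
      finally have "- (p / 2) * real (n - 1) = - L - \<epsilon> * L / 2 + p / 2" .
      moreover have "0 < \<epsilon> * L"
        using L(1) \<epsilon>(1) c by (intro mult_pos_pos) auto
      ultimately show ?thesis
        using p1 unfolding exp_le_cancel_iff by linarith
    qed
    also have "\<dots> = exp 1 * real n powr (- \<epsilon> / 4)"
      unfolding powr exp_add ..
    finally have "real n * (1 - p / 2) ^ (n - 1) \<le> exp 1 * real n powr (- \<epsilon> / 4)" .
    moreover have "(\<Sum>x\<in>Pow {..<n} - {{}}. ((1 + (1 - p) ^ card x) ^ (n - card x) - 1) / 2 ^ n)
        \<le> K * real n powr (- \<epsilon> / 4)"
      using K(2)[OF n \<epsilon>(1) pn p1] unfolding isolation_excess_def powr L_def .
    moreover have "measure_pmf.expectation (erdos_renyi_pmf n p) (pne_error {..<n})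
      \<le> real n * (1 - p / 2) ^ (n - 1) +
        2 * (\<Sum>x\<in>Pow {..<n} - {{}}. ((1 + (1 - p) ^ card x) ^ (n - card x) - 1) / 2 ^ n)"
      using n by (intro expectation_pne_error_le p0 p1) auto
    moreover have "(exp 1 + 2 * K) * r = exp 1 * r + 2 * (K * r)" for r :: real
      by (simp add: distrib_right)
    ultimately show ?thesis
      unfolding p_def[symmetric] by (smt (verit))
  qed
  thus ?thesis
    using that[of "exp 1 + 2 * K"] K(1) by (simp add: add_pos_pos)
qed

section \<open>From fixed graphs to the random graph\<close>

lemma random_num_pne_pmf_eq_bind:
  "random_num_pne_pmf n p = erdos_renyi_pmf n p \<bind> num_pne_pmf {..<n}"
  by (simp add: random_num_pne_pmf_def random_graph_game_pmf_def num_pne_pmf_def[abs_def]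
      map_bind_pmf map_pmf_def bind_assoc_pmf bind_return_pmf)

lemma expectation_le_tv_dist:
  fixes h :: "nat \<Rightarrow> real"
  assumes h: "\<And>i. \<bar>h i\<bar> \<le> 1"
  shows "measure_pmf.expectation P h - measure_pmf.expectation Q h \<le> tv_dist P Q"
proof -
  have 1: "(\<lambda>i. pmf P i * h i - pmf Q i * h i) sums
          (measure_pmf.expectation P h - measure_pmf.expectation Q h)"
    by (intro sums_diff expectation_pmf_nat_sums[OF h])
  have 2: "(\<lambda>i. \<bar>pmf P i - pmf Q i\<bar>) sums tv_dist P Q"
    unfolding tv_dist_def by (rule summable_sums[OF summable_abs_pmf_diff])
  have "pmf P i * h i - pmf Q i * h i \<le> \<bar>pmf P i - pmf Q i\<bar>" for i
  proof -
    have "(pmf P i - pmf Q i) * h i \<le> \<bar>pmf P i - pmf Q i\<bar> * \<bar>h i\<bar>"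
      by (metis abs_ge_self abs_mult)
    also have "\<dots> \<le> \<bar>pmf P i - pmf Q i\<bar>"
      using h[of i] by (simp add: mult_left_le)
    finally show ?thesis
      by (simp add: algebra_simps)
  qed
  thus ?thesis
    by (rule sums_le[OF _ 1 2])
qed

lemma finite_set_num_pne:
  assumes V: "finite V"
  shows "finite (set_pmf (num_pne_pmf V E))"
proof -
  have "neighbours V E v \<subseteq> V" for v
    by (auto simp: neighbours_def)
  hence "finite (SIGMA v:V. profiles (neighbours V E v))"
    using V finite_subset by (intro finite_SigmaI finite_profiles) blast+
  thus ?thesis
    unfolding num_pne_pmf_def game_pmf_def
    by (simp add: finite_set_Pi_coin)
qed

text \<open>Convexity of the distance through test functions: for fixed \<open>h\<close> the
  expectation under the mixture is the average over graphs, and each graph contributes at most its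
  own Chen-Stein error.\<close>

lemma tv_dist_random_num_pne_le:
  assumes n: "n > 0"
  shows "tv_dist (random_num_pne_pmf n p) (poisson_pmf 1)
    \<le> 12 * measure_pmf.expectation (erdos_renyi_pmf n p) (pne_error {..<n})"
proof (rule tv_dist_le)
  fix h :: "nat \<Rightarrow> real"
  assume h: "\<And>i. \<bar>h i\<bar> \<le> 1"
  define G where "G = erdos_renyi_pmf n p"
  define \<mu> where "\<mu> = measure_pmf.expectation (poisson_pmf 1) h"
  have fin: "finite (set_pmf G)"
    unfolding G_def by (rule finite_set_erdos_renyi)
  have int [simp]: "integrable (measure_pmf G) (u :: nat set set \<Rightarrow> real)" for u
    using fin by (rule integrable_measure_pmf_finite)
  have "measure_pmf.expectation (random_num_pne_pmf n p) h
      = measure_pmf.expectation G (\<lambda>E. measure_pmf.expectation (num_pne_pmf {..<n} E) h)"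
    unfolding random_num_pne_pmf_eq_bind G_def[symmetric] using fin
    by (simp add: pmf_expectation_bind[of "set_pmf G"] integral_measure_pmf[of "set_pmf G"]
        finite_set_num_pne)
  hence "measure_pmf.expectation (random_num_pne_pmf n p) h - \<mu>
      = measure_pmf.expectation G (\<lambda>E. measure_pmf.expectation (num_pne_pmf {..<n} E) h - \<mu>)"
    by simp
  also have "\<dots> \<le> measure_pmf.expectation G (\<lambda>E. 12 * pne_error {..<n} E)"
  proof (intro integral_mono int)
    fix E
    have "{..<n} \<noteq> {}"
      using n by (simp add: lessThan_empty_iff)
    thus "measure_pmf.expectation (num_pne_pmf {..<n} E) h - \<mu> \<le> 12 * pne_error {..<n} E"
      unfolding \<mu>_def using expectation_le_tv_dist[of h] h tv_dist_num_pne_le[of "{..<n}" E]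
      by (meson finite_lessThan order.trans)
  qed
  finally show "measure_pmf.expectation (random_num_pne_pmf n p) h
      - measure_pmf.expectation (poisson_pmf 1) h
    \<le> 12 * measure_pmf.expectation (erdos_renyi_pmf n p) (pne_error {..<n})"
    by (simp add: G_def \<mu>_def)
qed

lemma prob_tv_dist_num_pne_ge:
  assumes n: "n > 0" and \<theta>: "\<theta> > 0"
  shows "measure_pmf.prob (erdos_renyi_pmf n p)
      {E. tv_dist (num_pne_pmf {..<n} E) (poisson_pmf 1) \<le> 12 * \<theta>}
    \<ge> 1 - measure_pmf.expectation (erdos_renyi_pmf n p) (pne_error {..<n}) / \<theta>"
proof -
  define G where "G = erdos_renyi_pmf n p"
  have int: "integrable (measure_pmf G) (pne_error {..<n})"
    unfolding G_def by (rule integrable_measure_pmf_finite[OF finite_set_erdos_renyi])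
  have markov: "measure_pmf.prob G {E. \<theta> \<le> pne_error {..<n} E}
      \<le> measure_pmf.expectation G (pne_error {..<n}) / \<theta>"
    using integral_Markov_inequality_measure[OF int _ _ \<theta>, of UNIV] by (simp add: pne_error_nonneg)
  have "{..<n} \<noteq> {}"
    using n by (simp add: lessThan_empty_iff)
  hence tv: "tv_dist (num_pne_pmf {..<n} E) (poisson_pmf 1) \<le> 12 * pne_error {..<n} E" for E
    by (intro tv_dist_num_pne_le) auto
  have "- {E. \<theta> \<le> pne_error {..<n} E}
      \<subseteq> {E. tv_dist (num_pne_pmf {..<n} E) (poisson_pmf 1) \<le> 12 * \<theta>}"
  proof
    fix E assume "E \<in> - {E. \<theta> \<le> pne_error {..<n} E}"
    thus "E \<in> {E. tv_dist (num_pne_pmf {..<n} E) (poisson_pmf 1) \<le> 12 * \<theta>}"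
      using tv[of E] by simp
  qed
  hence "measure_pmf.prob G (- {E. \<theta> \<le> pne_error {..<n} E})
      \<le> measure_pmf.prob G {E. tv_dist (num_pne_pmf {..<n} E) (poisson_pmf 1) \<le> 12 * \<theta>}"
    by (intro measure_pmf.finite_measure_mono) auto
  moreover have "measure_pmf.prob G (- {E. \<theta> \<le> pne_error {..<n} E})
      = 1 - measure_pmf.prob G {E. \<theta> \<le> pne_error {..<n} E}"
    using measure_pmf.prob_compl[of "{E. \<theta> \<le> pne_error {..<n} E}" G] by (simp add: Compl_eq_Diff_UNIV)
  ultimately show ?thesis
    using markov unfolding G_def by linarith
qed

theorem theorem1p9:
  fixes c :: real
  assumes "c > 0"
  shows
    "(\<exists>C>0. \<exists>\<kappa>>0. \<forall>n::nat. \<forall>\<epsilon>::real.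
        2 \<le> n \<longrightarrow> c < \<epsilon> \<longrightarrow> \<epsilon> \<le> real n / ln (real n) - 2 \<longrightarrow>
        measure_pmf.prob (erdos_renyi_pmf n ((2 + \<epsilon>) * ln (real n) / real n))
          {E. tv_dist (num_pne_pmf {..<n} E) (poisson_pmf 1)
                \<le> C * real n powr (- \<epsilon> / 8) + exp (- \<kappa> * real n)}
        \<ge> 1 - 2 * real n powr (- \<epsilon> / 8))
     \<and>
     (\<forall>\<epsilon> :: nat \<Rightarrow> real.
        (\<forall>\<^sub>F n in sequentially. c < \<epsilon> n \<and> \<epsilon> n \<le> real n / ln (real n) - 2) \<longrightarrow>
        (\<lambda>n. tv_dist (random_num_pne_pmf n ((2 + \<epsilon> n) * ln (real n) / real n)) (poisson_pmf 1))
          \<longlonglongrightarrow> 0)"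
proof (intro conjI allI impI)
  obtain K where K: "K > 0"
    "\<And>n \<epsilon>. n \<ge> 2 \<Longrightarrow> c < \<epsilon> \<Longrightarrow> \<epsilon> \<le> real n / ln (real n) - 2 \<Longrightarrow>
       measure_pmf.expectation (erdos_renyi_pmf n ((2 + \<epsilon>) * ln (real n) / real n)) (pne_error {..<n})
         \<le> K * real n powr (- \<epsilon> / 4)"
    using expectation_pne_error_powr_le[OF assms] by blast
  show "\<exists>C>0. \<exists>\<kappa>>0. \<forall>n::nat. \<forall>\<epsilon>::real.
        2 \<le> n \<longrightarrow> c < \<epsilon> \<longrightarrow> \<epsilon> \<le> real n / ln (real n) - 2 \<longrightarrow>
        measure_pmf.prob (erdos_renyi_pmf n ((2 + \<epsilon>) * ln (real n) / real n))
          {E. tv_dist (num_pne_pmf {..<n} E) (poisson_pmf 1)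
                \<le> C * real n powr (- \<epsilon> / 8) + exp (- \<kappa> * real n)}
        \<ge> 1 - 2 * real n powr (- \<epsilon> / 8)"
  proof (rule exI[of _ "12 * K"], intro conjI exI[of _ "1 :: real"] allI impI)
    fix n :: nat and \<epsilon> :: real
    assume n: "2 \<le> n" and \<epsilon>: "c < \<epsilon>" "\<epsilon> \<le> real n / ln (real n) - 2"
    define G where "G = erdos_renyi_pmf n ((2 + \<epsilon>) * ln (real n) / real n)"
    \<comment> \<open>The mean error is at most K r^2, so Markov's inequality at level K r gives
      failure probability at most r, and level and failure probability have the same order.\<close>
    define r where "r = real n powr (- \<epsilon> / 8)"
    have r: "r > 0"
      using n by (simp add: r_def)
    have "real n powr (- \<epsilon> / 4) = r * r"
      by (simp add: r_def flip: powr_add)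
    hence "measure_pmf.expectation G (pne_error {..<n}) \<le> K * (r * r)"
      using K(2)[OF n \<epsilon>] by (simp add: G_def)
    hence "measure_pmf.expectation G (pne_error {..<n}) / (K * r) \<le> r"
      using r K(1) by (simp add: pos_divide_le_eq mult_ac)
    moreover have "1 - measure_pmf.expectation G (pne_error {..<n}) / (K * r) \<le>
        measure_pmf.prob G {E. tv_dist (num_pne_pmf {..<n} E) (poisson_pmf 1) \<le> 12 * (K * r)}"
      unfolding G_def using n K(1) r by (intro prob_tv_dist_num_pne_ge) auto
    moreover have "\<dots> \<le> measure_pmf.prob G {E. tv_dist (num_pne_pmf {..<n} E) (poisson_pmf 1)
        \<le> 12 * K * r + exp (- 1 * real n)}"
      by (intro measure_pmf.finite_measure_mono subsetI CollectI)
         (simp_all add: mult.assoc add_increasing2)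
    ultimately show "measure_pmf.prob (erdos_renyi_pmf n ((2 + \<epsilon>) * ln (real n) / real n))
          {E. tv_dist (num_pne_pmf {..<n} E) (poisson_pmf 1)
                \<le> 12 * K * real n powr (- \<epsilon> / 8) + exp (- 1 * real n)}
        \<ge> 1 - 2 * real n powr (- \<epsilon> / 8)"
      using r unfolding G_def[symmetric] r_def[symmetric] by linarith
  qed (use K(1) in auto)
  fix \<epsilon> :: "nat \<Rightarrow> real"
  assume \<epsilon>: "\<forall>\<^sub>F n in sequentially. c < \<epsilon> n \<and> \<epsilon> n \<le> real n / ln (real n) - 2"
  show "(\<lambda>n. tv_dist (random_num_pne_pmf n ((2 + \<epsilon> n) * ln (real n) / real n)) (poisson_pmf 1))
          \<longlonglongrightarrow> 0"
  proof (rule tendsto_sandwich)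
    show "\<forall>\<^sub>F n in sequentially.
        0 \<le> tv_dist (random_num_pne_pmf n ((2 + \<epsilon> n) * ln (real n) / real n)) (poisson_pmf 1)"
      by (simp add: tv_dist_nonneg)
    show "\<forall>\<^sub>F n in sequentially.
        tv_dist (random_num_pne_pmf n ((2 + \<epsilon> n) * ln (real n) / real n)) (poisson_pmf 1)
          \<le> 12 * (K * real n powr (- c / 4))"
      using \<epsilon> eventually_ge_at_top[of 2]
    proof eventually_elim
      case (elim n)
      have "real n powr (- \<epsilon> n / 4) \<le> real n powr (- c / 4)"
        using elim by (intro powr_mono) auto
      hence "K * real n powr (- \<epsilon> n / 4) \<le> K * real n powr (- c / 4)"
        using K(1) by simp
      thus ?case
        using K(2)[of n "\<epsilon> n"] elim
          tv_dist_random_num_pne_le[of n "(2 + \<epsilon> n) * ln (real n) / real n"] by linarith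
    qed
    show "(\<lambda>n. 12 * (K * real n powr (- c / 4))) \<longlonglongrightarrow> 0"
      using assms by real_asymp
  qed simp
qed

end
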